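(* Let $H,K\in M_n(\mathbb{C})$ be Hermitian and $1\le t\le 2$. Then $$e^{(1-t)H/2}e^{tK}e^{(1-t)H/2}\prec_{(\log)} e^H\#_te^K.$$
   Context: For positive definite $X,Y$ and $t\in\mathbb{R}$, $X\#_tY:=X^{1/2}(X^{-1/2}YX^{-1/2})^tX^{1/2}$. For $A,B\in M_n(\mathbb{C})$ with singular values $s_1(A)\ge\dots\ge s_n(A)$ and $s_1(B)\ge\dots\ge s_n(B)$, write $A\prec_{(\log)}B$ if $\prod_{i=1}^k s_i(A)\le\prod_{i=1}^k s_i(B)$ for $1\le k\le n$, with equality for $k=n$. *)

theory Defs
  imports Complex_Main "Jordan_Normal_Form.Schur_Decomposition" "Jordan_Normal_Form.Char_Poly"
begin

definition hermitian_mat :: "nat \<Rightarrow> complex mat \<Rightarrow> bool" where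
  "hermitian_mat n A \<longleftrightarrow> A \<in> carrier_mat n n \<and> mat_adjoint A = A"

definition unitary_mat :: "nat \<Rightarrow> complex mat \<Rightarrow> bool" where
  "unitary_mat n U \<longleftrightarrow> U \<in> carrier_mat n n \<and> U * mat_adjoint U = 1\<^sub>m n
      \<and> mat_adjoint U * U = 1\<^sub>m n"

definition mexp :: "complex mat \<Rightarrow> complex mat" where
  "mexp A = mat (dim_row A) (dim_col A)
      (\<lambda>(i,j). \<Sum>k. (A ^\<^sub>m k) $$ (i,j) / of_real (fact k))"

definition mpow :: "nat \<Rightarrow> complex mat \<Rightarrow> real \<Rightarrow> complex mat" where
  "mpow n X t = (SOME P. \<exists>U d. unitary_mat n U \<and> (\<forall>i<n. d i > 0)
      \<and> X = U * mat_diag n (\<lambda>i. complex_of_real (d i)) * mat_adjoint U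
      \<and> P = U * mat_diag n (\<lambda>i. complex_of_real (d i powr t)) * mat_adjoint U)"

definition geo_mean :: "nat \<Rightarrow> complex mat \<Rightarrow> real \<Rightarrow> complex mat \<Rightarrow> complex mat" where
  "geo_mean n X t Y = mpow n X (1/2)
      * mpow n (mpow n X (-1/2) * Y * mpow n X (-1/2)) t * mpow n X (1/2)"

(* singular values s_1 \<ge> ... \<ge> s_n, indexed 0..n-1: nonnegative square roots of the
   eigenvalues (with algebraic multiplicity) of A^* A, in decreasing order *)
definition sing_vals :: "nat \<Rightarrow> complex mat \<Rightarrow> nat \<Rightarrow> real" where
  "sing_vals n A = (SOME s. (\<forall>i<n. s i \<ge> 0) \<and> (\<forall>i j. i \<le> j \<and> j < n \<longrightarrow> s j \<le> s i)
      \<and> char_poly (mat_adjoint A * A) = (\<Prod>i<n. [:- complex_of_real ((s i)^2), 1:]))"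

definition log_majorized :: "nat \<Rightarrow> complex mat \<Rightarrow> complex mat \<Rightarrow> bool" where
  "log_majorized n A B \<longleftrightarrow>
     (\<forall>k\<in>{1..n}. (\<Prod>i<k. sing_vals n A i) \<le> (\<Prod>i<k. sing_vals n B i))
     \<and> (\<Prod>i<n. sing_vals n A i) = (\<Prod>i<n. sing_vals n B i)"

end

theory Submission
  imports Defs "HOL-Analysis.Elementary_Metric_Spaces"
begin

text \<open>
  Write \<open>A = e\<^sup>H\<close>, \<open>B = e\<^sup>K\<close>, \<open>s = t - 1\<close> and \<open>C = A\<^bsup>-1/2\<^esup> B A\<^bsup>-1/2\<^esup>\<close>. Compound matrices are
  multiplicative (Cauchy--Binet), commute with adjoints and real powers, and the largest eigenvalue
  of the \<open>k\<close>-th compound is the product of the \<open>k\<close> largest eigenvalues; so it suffices to compare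
  the largest eigenvalues of both sides, and the determinants. By scaling \<open>B\<close>, this amounts to
  showing that \<open>A #\<^sub>t B \<le> 1\<close>, i.e. \<open>C\<^bsup>1+s\<^esup> \<le> A\<^bsup>-1\<^esup>\<close>, implies \<open>B\<^bsup>1+s\<^esup> \<le> A\<^bsup>s\<^esup>\<close>. Inverting gives
  \<open>C\<^bsup>1/2\<^esup> A C\<^bsup>1/2\<^esup> \<le> C\<^bsup>-s\<^esup>\<close>, and with \<open>T = A\<^bsup>1/2\<^esup> C\<^bsup>1/2\<^esup>\<close> we have \<open>B = T T\<^sup>*\<close> and
  \<open>B\<^bsup>1+s\<^esup> = T (T\<^sup>* T)\<^bsup>s\<^esup> T\<^sup>*\<close>. Two applications of the Loewner--Heinz inequality, with exponents
  \<open>s\<close> and \<open>1 - s\<close>, yield \<open>B\<^bsup>1+s\<^esup> \<le> A\<^bsup>1/2\<^esup> C\<^bsup>1-ss\<^esup> A\<^bsup>1/2\<^esup> \<le> A\<^bsup>1/2\<^esup> A\<^bsup>s-1\<^esup> A\<^bsup>1/2\<^esup> = A\<^bsup>s\<^esup>\<close>.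
\<close>

subsection \<open>Unitary diagonalization of Hermitian matrices\<close>

lemma mat_adjoint_alt:
  "mat_adjoint A = mat (dim_col A) (dim_row A) (\<lambda>(i,j). conjugate (A $$ (j,i)))"
  by (rule eq_matI) (auto simp: mat_adjoint_def mat_of_rows_def)

lemma mat_adjoint_dim [simp]:
  "dim_row (mat_adjoint A) = dim_col A" "dim_col (mat_adjoint A) = dim_row A"
  by (auto simp: mat_adjoint_alt)

lemma mat_adjoint_index [simp]:
  "i < dim_col A \<Longrightarrow> j < dim_row A \<Longrightarrow> mat_adjoint A $$ (i,j) = conjugate (A $$ (j,i))"
  by (auto simp: mat_adjoint_alt)

lemma mat_adjoint_carrier [simp]: "A \<in> carrier_mat m n \<Longrightarrow> mat_adjoint A \<in> carrier_mat n m"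
  by auto

lemma mat_adjoint_adjoint [simp]: "mat_adjoint (mat_adjoint A) = A"
  by (rule eq_matI) auto

lemma mat_adjoint_mult:
  fixes A B :: "complex mat"
  assumes "A \<in> carrier_mat m n" "B \<in> carrier_mat n k"
  shows "mat_adjoint (A * B) = mat_adjoint B * mat_adjoint A"
  using assms by (intro eq_matI) (auto simp: scalar_prod_def sum_conjugate mult.commute)

lemma mat_adjoint_one [simp]: "mat_adjoint (1\<^sub>m n :: complex mat) = 1\<^sub>m n"
  by (rule eq_matI) auto

lemma mat_adjoint_diag: "mat_adjoint (mat_diag n f) = mat_diag n (\<lambda>i. cnj (f i))"
  by (rule eq_matI) (auto simp: mat_diag_def)

lemma cscalar_prod_adjoint:
  fixes A :: "complex mat"
  assumes "A \<in> carrier_mat m n" "v \<in> carrier_vec n" "w \<in> carrier_vec m"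
  shows "(A *\<^sub>v v) \<bullet>c w = v \<bullet>c (mat_adjoint A *\<^sub>v w)"
proof -
  have "(A *\<^sub>v v) \<bullet>c w = (\<Sum>i<m. \<Sum>j<n. A $$ (i,j) * v $ j * cnj (w $ i))"
    using assms by (auto simp: scalar_prod_def sum_distrib_right atLeast0LessThan)
  also have "\<dots> = (\<Sum>j<n. \<Sum>i<m. A $$ (i,j) * v $ j * cnj (w $ i))"
    by (rule sum.swap)
  also have "\<dots> = v \<bullet>c (mat_adjoint A *\<^sub>v w)"
    using assms by (auto simp: scalar_prod_def sum_distrib_left atLeast0LessThan mult_ac
        intro!: sum.cong)
  finally show ?thesis .
qed

lemma cscalar_prod_self: "(v :: complex vec) \<bullet>c v = of_real (\<Sum>i<dim_vec v. (cmod (v $ i))\<^sup>2)"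
  by (auto simp: scalar_prod_def atLeast0LessThan complex_norm_square simp del: of_real_power)

lemma cscalar_prod_self_pos:
  fixes v :: "complex vec"
  assumes "v \<in> carrier_vec n" "v \<noteq> 0\<^sub>v n"
  shows "Re (v \<bullet>c v) > 0"
proof -
  have "v \<bullet>c v \<noteq> 0" using assms by simp
  moreover have "Re (v \<bullet>c v) \<ge> 0" by (simp add: cscalar_prod_self sum_nonneg)
  moreover have "Im (v \<bullet>c v) = 0" by (simp add: cscalar_prod_self)
  ultimately show ?thesis by (auto simp: complex_eq_iff)
qed

text \<open>Products of square matrices of a fixed size, as conditional rewrite rules whose size is
  not a schematic variable.\<close>

context fixes n :: nat
begin

lemma mult_carrier_square [simp]:
  "A \<in> carrier_mat n n \<Longrightarrow> B \<in> carrier_mat n n \<Longrightarrow> A * B \<in> carrier_mat n n"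
  by simp

lemma assoc_square:
  fixes A :: "complex mat"
  shows "A \<in> carrier_mat n n \<Longrightarrow> B \<in> carrier_mat n n \<Longrightarrow> C \<in> carrier_mat n n \<Longrightarrow>
    A * B * C = A * (B * C)"
  by (rule assoc_mult_mat)

lemma adjoint_mult_square:
  fixes A :: "complex mat"
  shows "A \<in> carrier_mat n n \<Longrightarrow> B \<in> carrier_mat n n \<Longrightarrow> mat_adjoint (A * B)
    = mat_adjoint B * mat_adjoint A"
  by (rule mat_adjoint_mult)

lemma unitary_matI:
  assumes "U \<in> carrier_mat n n" "mat_adjoint U * U = 1\<^sub>m n"
  shows "unitary_mat n U"
  using mat_mult_left_right_inverse[OF _ assms(1,2)] assms by (simp add: unitary_mat_def)

lemma unitary_carrier [simp]: "unitary_mat n U \<Longrightarrow> U \<in> carrier_mat n n"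
  by (simp add: unitary_mat_def)

lemma unitary_simps:
  assumes "unitary_mat n U"
  shows "mat_adjoint U * U = 1\<^sub>m n" "U * mat_adjoint U = 1\<^sub>m n"
    "X \<in> carrier_mat n n \<Longrightarrow> mat_adjoint U * (U * X) = X"
    "X \<in> carrier_mat n n \<Longrightarrow> U * (mat_adjoint U * X) = X"
  using assms by (auto simp: unitary_mat_def assoc_square[symmetric])

lemma unitary_mult:
  assumes "unitary_mat n U" "unitary_mat n V"
  shows "unitary_mat n (U * V)"
  by (rule unitary_matI) (use assms in \<open>auto simp: adjoint_mult_square assoc_square unitary_simps\<close>)

end

text \<open>Complete \<open>v\<close> to a basis and orthogonalize: Gram-Schmidt keeps the first
  vector, and dividing each vector by its norm gives the columns of \<open>W\<close>. The scalar
  \<open>c\<close> is this normalization, harmless because \<open>v\<close> will be an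
  eigenvector.\<close>

lemma unitary_first_column:
  fixes v :: "complex vec"
  assumes v: "v \<in> carrier_vec n" "v \<noteq> 0\<^sub>v n" and n: "n \<noteq> 0"
  shows "\<exists>W c. unitary_mat n W \<and> col W 0 = c \<cdot>\<^sub>v v"
proof -
  interpret cof_vec_space n "TYPE(complex)" .
  define b where "b = basis_completion v"
  note bc = basis_completion[OF v, folded b_def]
  define ws where "ws = gram_schmidt n b"
  have ws: "set ws \<subseteq> carrier_vec n" "corthogonal ws" "length ws = n"
    using gram_schmidt_result[OF bc(2,4,5) ws_def] bc(6) by auto
  have "b = v # tl b" using bc(6,7) n by (cases b) auto
  hence "hd ws = v" unfolding ws_def using gram_schmidt_hd[OF v(1)] by metis
  hence ws0: "ws ! 0 = v" using ws(3) n by (metis hd_conv_nth length_0_conv)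
  define r where "r = (\<lambda>i. sqrt (Re (ws ! i \<bullet>c ws ! i)))"
  have wsi: "ws ! i \<in> carrier_vec n" if "i < n" for i using ws that by auto
  have rpos: "r i > 0" and rsq: "ws ! i \<bullet>c ws ! i = of_real (r i * r i)" if "i < n" for i
  proof -
    have "ws ! i \<bullet>c ws ! i \<noteq> 0" using corthogonalD[OF ws(2), of i i] ws(3) that by simp
    hence "ws ! i \<noteq> 0\<^sub>v n" using wsi[OF that] by auto
    hence *: "Re (ws ! i \<bullet>c ws ! i) > 0" using cscalar_prod_self_pos wsi[OF that] by blast
    then show "r i > 0" by (simp add: r_def)
    have "r i * r i = Re (ws ! i \<bullet>c ws ! i)" using * by (simp add: r_def)
    then show "ws ! i \<bullet>c ws ! i = of_real (r i * r i)"
      by (simp add: cscalar_prod_self del: of_real_mult)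
  qed
  define W where "W = mat n n (\<lambda>(i,j). (ws ! j $ i) / of_real (r j))"
  have WI: "mat_adjoint W * W = 1\<^sub>m n"
  proof (rule eq_matI)
    fix i j assume ij: "i < dim_row (1\<^sub>m n :: complex mat)" "j < dim_col (1\<^sub>m n :: complex mat)"
    then have ij: "i < n" "j < n" by auto
    have "(mat_adjoint W * W) $$ (i,j) = (\<Sum>l<n. cnj (ws ! i $ l) / of_real (r i) * (ws ! j $ l /
        of_real (r j)))"
      using ij by (simp add: W_def scalar_prod_def atLeast0LessThan)
    also have "\<dots> = (\<Sum>l<n. ws ! j $ l * cnj (ws ! i $ l)) / (of_real (r i) * of_real (r j))"
      by (simp add: sum_divide_distrib mult_ac)
    also have "(\<Sum>l<n. ws ! j $ l * cnj (ws ! i $ l)) = ws ! j \<bullet>c ws ! i"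
      using wsi[OF ij(1)] wsi[OF ij(2)] by (auto simp: scalar_prod_def atLeast0LessThan)
    also have "\<dots> / (of_real (r i) * of_real (r j)) = (if i = j then 1 else 0)"
      using corthogonalD[OF ws(2), of j i] ws(3) ij rpos[OF ij(1)] rsq[OF ij(1)] by auto
    finally show "(mat_adjoint W * W) $$ (i,j) = 1\<^sub>m n $$ (i,j)" using ij by auto
  qed (auto simp: W_def)
  have "W \<in> carrier_mat n n" by (simp add: W_def)
  then have "unitary_mat n W" using WI by (rule unitary_matI)
  moreover have "col W 0 = (1 / of_real (r 0)) \<cdot>\<^sub>v v"
    using n v(1) by (intro eq_vecI) (auto simp: W_def ws0)
  ultimately show ?thesis by blast
qed

lemma mat_adjoint_four_block:
  fixes A :: "complex mat"
  assumes "A \<in> carrier_mat a b" "B \<in> carrier_mat a d" "C \<in> carrier_mat c b" "D \<in> carrier_mat c d"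
  shows "mat_adjoint (four_block_mat A B C D)
    = four_block_mat (mat_adjoint A) (mat_adjoint C) (mat_adjoint B) (mat_adjoint D)"
  using assms by (intro eq_matI) auto

lemma mult_four_block_diag:
  fixes A :: "complex mat"
  assumes "A \<in> carrier_mat k k" "A' \<in> carrier_mat k k" "B \<in> carrier_mat m m" "B' \<in> carrier_mat m m"
  shows "four_block_mat A (0\<^sub>m k m) (0\<^sub>m m k) B * four_block_mat A' (0\<^sub>m k m) (0\<^sub>m m k) B'
    = four_block_mat (A * A') (0\<^sub>m k m) (0\<^sub>m m k) (B * B')"
  using assms by (subst mult_four_block_mat[of _ k k _ m _ m]) auto

text \<open>The order of the eigenvalues is prescribed by \<open>es\<close>, so that they can be sorted later on.\<close>

lemma hermitian_diagonalization:
  assumes "hermitian_mat n A" "char_poly A = (\<Prod>e\<leftarrow>es. [:- e, 1:])"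
  shows "\<exists>U. unitary_mat n U \<and> A = U * mat_diag n (\<lambda>i. es ! i) * mat_adjoint U"
  using assms
proof (induction es arbitrary: n A)
  case Nil
  then have A: "A \<in> carrier_mat n n" by (simp add: hermitian_mat_def)
  \<comment> \<open>The empty product is the constant 1, whose degree 0 must be the size of
    \<open>A\<close>.\<close>
  with degree_monic_char_poly[OF A] Nil have "n = 0" by simp
  with A show ?case by (intro exI[of _ "1\<^sub>m 0"]) (auto simp: unitary_mat_def)
next
  case (Cons e es)
  from Cons.prems have A: "A \<in> carrier_mat n n" and hA: "mat_adjoint A = A"
    by (auto simp: hermitian_mat_def)
  let ?q = "\<Prod>e\<leftarrow>es. [:- e, 1:]"
  have cp: "char_poly A = [:- e, 1:] * ?q" using Cons.prems by simp
  have "eigenvalue A e" unfolding eigenvalue_root_char_poly[OF A] cp by simp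
  then obtain v where v: "v \<in> carrier_vec n" "v \<noteq> 0\<^sub>v n" "A *\<^sub>v v = e \<cdot>\<^sub>v v"
    using A unfolding eigenvalue_def eigenvector_def by auto
  then have n: "n \<noteq> 0" by auto
  then obtain m where m: "n = Suc m" by (cases n) auto
  obtain W c where W: "unitary_mat n W" and colW: "col W 0 = c \<cdot>\<^sub>v v"
    using unitary_first_column[OF v(1,2) n] by blast
  note [simp] = unitary_carrier[OF W] carrier_matD[OF unitary_carrier[OF W]]
  define A' where "A' = mat_adjoint W * A * W"
  have A': "A' \<in> carrier_mat n n" using A by (simp add: A'_def)
  have hA': "mat_adjoint A' = A'" unfolding A'_def using A hA by
      (simp add: adjoint_mult_square[of _ n] assoc_square[of _ n])
  have col0: "A' $$ (i,0) = (if i = 0 then e else 0)" if "i < n" for i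
  proof -
    have "col (A * W) 0 = A *\<^sub>v col W 0" using A n by (intro col_mult2) auto
    also have "\<dots> = e \<cdot>\<^sub>v col W 0" using A v by
        (simp add: colW mult_mat_vec[of _ n n] smult_smult_assoc mult.commute)
    finally have c0: "col (A * W) 0 = e \<cdot>\<^sub>v col W 0" .
    have "A' $$ (i,0) = (mat_adjoint W * (A * W)) $$ (i,0)" using A by
        (simp add: A'_def assoc_square[of _ n])
    also have "\<dots> = row (mat_adjoint W) i \<bullet> col (A * W) 0" using that n A by (intro
        index_mult_mat) auto
    also have "\<dots> = e * (row (mat_adjoint W) i \<bullet> col W 0)" unfolding c0 using that
        by (intro scalar_prod_smult_distrib[of _ n]) (auto simp: carrier_vecI)
    also have "row (mat_adjoint W) i \<bullet> col W 0 = (mat_adjoint W * W) $$ (i,0)" using that n by simp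
    also have "\<dots> = (if i = 0 then 1 else 0)" using that n W by (simp add: unitary_simps[OF W])
    finally show ?thesis by simp
  qed
  \<comment> \<open>The first column comes from the eigenvector equation; Hermitian symmetry carries
    it over to the first row, so \<open>A'\<close> is block diagonal.\<close>
  have row0: "A' $$ (0,j) = (if j = 0 then e else 0)" if "j < n" for j
  proof (cases "j = 0")
    case False
    have "A' $$ (0,j) = conjugate (A' $$ (j,0))" using hA' A' that n
        by (metis carrier_matD mat_adjoint_index neq0_conv)
    then show ?thesis using col0[OF that] False by simp
  qed (use col0 n in auto)
  define A3 where "A3 = mat m m (\<lambda>(i,j). A' $$ (Suc i, Suc j))"
  let ?e = "mat 1 1 (\<lambda>_. e)"
  have A3: "A3 \<in> carrier_mat m m" by (simp add: A3_def)
  have blk: "A' = four_block_mat ?e (0\<^sub>m 1 m) (0\<^sub>m m 1) A3"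
    using A' by (intro eq_matI) (auto simp: m A3_def row0 col0)
  have hA3: "hermitian_mat m A3"
    unfolding hermitian_mat_def
  proof
    show "mat_adjoint A3 = A3"
    proof (rule eq_matI)
      fix i j assume "i < dim_row A3" "j < dim_col A3"
      then have ij: "i < m" "j < m" by (auto simp: A3_def)
      have "A' $$ (Suc i, Suc j) = conjugate (A' $$ (Suc j, Suc i))"
        using hA' A' ij m by (metis carrier_matD mat_adjoint_index Suc_less_eq)
      then show "mat_adjoint A3 $$ (i,j) = A3 $$ (i,j)" using ij by (simp add: A3_def)
    qed (auto simp: A3_def)
  qed (rule A3)
  \<comment> \<open>Similarity preserves the characteristic polynomial. Cancelling the factor of
    \<open>e\<close> leaves exactly the list \<open>es\<close> for \<open>A3\<close>, in its given
    order, as the induction hypothesis requires.\<close>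
  have "similar_mat A' A"
    unfolding similar_mat_def
    by (intro exI[of _ "mat_adjoint W"] exI[of _ W] similar_mat_witI[of _ _ n])
       (use A A' in \<open>auto simp: A'_def unitary_simps[OF W]\<close>)
  then have "char_poly A' = [:- e, 1:] * ?q" using char_poly_similar cp by metis
  also have "char_poly A' = char_poly ?e * char_poly A3"
    unfolding blk by (rule char_poly_four_block_zeros_col[of _ _ m]) (auto simp: A3)
  also have "char_poly ?e = [: -e,1 :]"
    by (simp add: char_poly_defs det_def sign_def)
  finally have "char_poly A3 = ?q"
    by (metis mult_cancel_left pCons_eq_0_iff zero_neq_one)
  from Cons.IH[OF hA3 this] obtain U3 where U3: "unitary_mat m U3"
    and dec: "A3 = U3 * mat_diag m (\<lambda>i. es ! i) * mat_adjoint U3" by blast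
  note [simp] = unitary_carrier[OF U3]
  let ?U = "four_block_mat (1\<^sub>m 1) (0\<^sub>m 1 m) (0\<^sub>m m 1) U3"
  have adjU: "mat_adjoint ?U = four_block_mat (1\<^sub>m 1) (0\<^sub>m 1 m) (0\<^sub>m m 1) (mat_adjoint U3)"
  proof -
    have "mat_adjoint (0\<^sub>m a b :: complex mat) = 0\<^sub>m b a" for a b by (rule eq_matI) auto
    then show ?thesis by (subst mat_adjoint_four_block[of _ 1 1 _ m _ m]) auto
  qed
  have Uc: "?U \<in> carrier_mat n n"
    using four_block_carrier_mat[of "1\<^sub>m 1" 1 1 U3 m m] by (simp add: m)
  have uU: "unitary_mat n ?U"
  proof (rule unitary_matI[OF Uc])
    show "mat_adjoint ?U * ?U = 1\<^sub>m n"
      unfolding adjU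
      by (subst mult_four_block_diag) (auto simp: m unitary_simps[OF U3] intro!: eq_matI)
  qed
  have dg: "mat_diag n (\<lambda>i. (e # es) ! i) = four_block_mat ?e (0\<^sub>m 1 m) (0\<^sub>m m 1) (mat_diag m (\<lambda>i.
      es ! i))"
    by (rule eq_matI) (auto simp: m mat_diag_def nth_Cons split: nat.splits)
  have "?U * mat_diag n (\<lambda>i. (e # es) ! i) * mat_adjoint ?U = A'"
    unfolding adjU dg blk
    by (subst mult_four_block_diag mult_four_block_diag; (simp add: dec)?)+
  then have "A' = ?U * mat_diag n (\<lambda>i. (e # es) ! i) * mat_adjoint ?U" by simp
  moreover have "A = W * A' * mat_adjoint W"
    using A by (simp add: A'_def assoc_square[of _ n] unitary_simps[OF W])
  ultimately have "A = (W * ?U) * mat_diag n (\<lambda>i. (e # es) ! i) * mat_adjoint (W * ?U)"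
    using Uc by (simp add: assoc_square[of _ n] adjoint_mult_square[of _ n] del: carrier_matI)
  then show ?case using unitary_mult[OF W uU] by blast
qed

subsection \<open>Real powers of positive definite matrices\<close>

definition udiag :: "nat \<Rightarrow> complex mat \<Rightarrow> (nat \<Rightarrow> real) \<Rightarrow> complex mat" where
  "udiag n U d = U * mat_diag n (\<lambda>i. complex_of_real (d i)) * mat_adjoint U"

text \<open>The spectral form is taken as the definition because it has the shape used in
  \<open>mpow\<close>. The link with positive quadratic forms is made by \<open>qform_pos\<close>
  and \<open>pos_def_sorted\<close>.\<close>

definition pos_def :: "nat \<Rightarrow> complex mat \<Rightarrow> bool" where
  "pos_def n A \<longleftrightarrow> (\<exists>U d. unitary_mat n U \<and> (\<forall>i<n. d i > 0) \<and> A = udiag n U d)"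

definition qform :: "complex mat \<Rightarrow> complex vec \<Rightarrow> real" where
  "qform A v = Re ((A *\<^sub>v v) \<bullet>c v)"

text \<open>On Hermitian matrices this is the Loewner order. Since \<open>qform\<close> takes real
  parts, no Hermitian condition has to be carried along.\<close>

definition mat_le :: "nat \<Rightarrow> complex mat \<Rightarrow> complex mat \<Rightarrow> bool" where
  "mat_le n A B \<longleftrightarrow> (\<forall>v\<in>carrier_vec n. qform A v \<le> qform B v)"

lemma mat_diag_cong: "(\<And>i. i < n \<Longrightarrow> f i = g i) \<Longrightarrow> mat_diag n f = mat_diag n g"
  by (auto simp: mat_diag_def)

context fixes n :: nat
begin

lemma mult_mat_vec_carrier_square [simp]:
  "A \<in> carrier_mat n n \<Longrightarrow> v \<in> carrier_vec n \<Longrightarrow> A *\<^sub>v v \<in> carrier_vec n"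
  by simp

lemma mult_mat_vec_zero [simp]:
  fixes A :: "complex mat"
  shows "A \<in> carrier_mat n n \<Longrightarrow> A *\<^sub>v 0\<^sub>v n = 0\<^sub>v n"
  by (intro eq_vecI) auto

lemma mult_one_square [simp]:
  fixes A :: "complex mat"
  shows "A \<in> carrier_mat n n \<Longrightarrow> A * 1\<^sub>m n = A" "A \<in> carrier_mat n n \<Longrightarrow> 1\<^sub>m n * A = A"
  by simp_all

lemma udiag_carrier [simp]: "unitary_mat n U \<Longrightarrow> udiag n U d \<in> carrier_mat n n"
  by (auto simp: udiag_def)

lemma udiag_cong: "(\<And>i. i < n \<Longrightarrow> d i = e i) \<Longrightarrow> udiag n U d = udiag n U e"
  unfolding udiag_def by (subst mat_diag_cong[of n _ "\<lambda>i. complex_of_real (e i)"]) auto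

lemma udiag_mult:
  assumes "unitary_mat n U"
  shows "udiag n U d * udiag n U e = udiag n U (\<lambda>i. d i * e i)"
proof -
  have "mat_diag n f * (mat_diag n g * X) = mat_diag n (\<lambda>i. f i * g i) * X"
    if "X \<in> carrier_mat n n" for f g :: "nat \<Rightarrow> complex" and X
    using that by (simp add: assoc_square[of _ n, symmetric])
  then show ?thesis
    using assms by (simp add: udiag_def assoc_square[of _ n] unitary_simps[OF assms])
qed

lemma udiag_one: "unitary_mat n U \<Longrightarrow> udiag n U (\<lambda>_. 1) = 1\<^sub>m n"
  by (simp add: udiag_def unitary_simps)

lemma udiag_adjoint [simp]: "unitary_mat n U \<Longrightarrow> mat_adjoint (udiag n U d) = udiag n U d"
  by (simp add: udiag_def adjoint_mult_square[of _ n] assoc_square[of _ n] mat_adjoint_diag)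

lemma udiag_smult:
  assumes "unitary_mat n U"
  shows "complex_of_real c \<cdot>\<^sub>m udiag n U d = udiag n U (\<lambda>i. c * d i)"
proof -
  have "mat_diag n (\<lambda>i. complex_of_real (c * d i))
      = complex_of_real c \<cdot>\<^sub>m mat_diag n (\<lambda>i. complex_of_real (d i))"
    by (rule eq_matI) (auto simp: mat_diag_def)
  then show ?thesis using unitary_carrier[OF assms]
    by (simp add: udiag_def mult_smult_distrib[of _ n n _ n] mult_smult_assoc_mat[of _ n n _ n])
qed

text \<open>In the two eigenbases the relation reads \<open>d i * W(i,j) = W(i,j) * e j\<close> for
  \<open>W = U* T V\<close>. So either \<open>W(i,j) = 0\<close> or \<open>d i = e j\<close>, and
  both survive applying \<open>h\<close>. The case \<open>T = 1\<close> makes functions of a matrix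
  independent of the chosen diagonalization.\<close>

lemma udiag_intertwine:
  assumes U: "unitary_mat n U" and V: "unitary_mat n V" and T: "T \<in> carrier_mat n n"
    and eq: "udiag n U d * T = T * udiag n V e"
  shows "udiag n U (\<lambda>i. h (d i)) * T = T * udiag n V (\<lambda>i. h (e i))"
proof -
  let ?D = "\<lambda>f. mat_diag n (\<lambda>i. complex_of_real (f i))"
  note [simp] = unitary_carrier[OF U] unitary_carrier[OF V] T
  define W where "W = mat_adjoint U * T * V"
  have W: "W \<in> carrier_mat n n" by (simp add: W_def)
  have key: "?D f * W = W * ?D g \<longleftrightarrow> (\<forall>i<n. \<forall>j<n. of_real (f i) * W $$ (i,j)
      = W $$ (i,j) * of_real (g j))" for f g
    unfolding mat_diag_mult_left[OF W] mat_diag_mult_right[OF W] mat_eq_iff by auto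
  have "?D d * W = mat_adjoint U * (udiag n U d * T) * V"
    by (simp add: W_def udiag_def assoc_square[of _ n] unitary_simps[OF U])
  also have "\<dots> = W * ?D e"
    by (simp add: eq W_def, simp add: udiag_def assoc_square[of _ n] unitary_simps[OF V])
  finally have "\<forall>i<n. \<forall>j<n. of_real (d i) * W $$ (i,j) = W $$ (i,j) * of_real (e j)" by
      (simp add: key)
  then have "?D (\<lambda>i. h (d i)) * W = W * ?D (\<lambda>i. h (e i))"
    unfolding key by (auto simp: mult.commute) metis
  then have "U * (?D (\<lambda>i. h (d i)) * W) * mat_adjoint V
      = U * (W * ?D (\<lambda>i. h (e i))) * mat_adjoint V"
    by simp
  then show ?thesis
    by (simp add: W_def udiag_def assoc_square[of _ n] unitary_simps[OF U] unitary_simps[OF V])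
qed

text \<open>\<open>mpow\<close> is a choice among spectral decompositions; intertwining two of them
  by the identity matrix shows that all give the same power.\<close>

lemma mpow_udiag:
  assumes U: "unitary_mat n U" and d: "\<And>i. i < n \<Longrightarrow> d i > 0"
  shows "mpow n (udiag n U d) t = udiag n U (\<lambda>i. d i powr t)"
  unfolding mpow_def udiag_def[symmetric]
proof (rule some_equality)
  fix P assume "\<exists>V e. unitary_mat n V \<and> (\<forall>i<n. 0 < e i) \<and> udiag n U d = udiag n V e
      \<and> P = udiag n V (\<lambda>i. e i powr t)"
  then obtain V e where V: "unitary_mat n V" "udiag n U d = udiag n V e"
    and P: "P = udiag n V (\<lambda>i. e i powr t)" by blast
  have "udiag n U d * 1\<^sub>m n = 1\<^sub>m n * udiag n V e" using U V by simp
  from udiag_intertwine[OF U V(1) _ this, of "\<lambda>x. x powr t"]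
  show "P = udiag n U (\<lambda>i. d i powr t)" using U V(1) by (simp add: P)
qed (use U d in blast)

lemma pos_def_udiag: "unitary_mat n U \<Longrightarrow> (\<And>i. i < n \<Longrightarrow> d i > 0) \<Longrightarrow> pos_def n (udiag n U d)"
  by (auto simp: pos_def_def)

lemma pos_defE:
  assumes "pos_def n A"
  obtains U d where "unitary_mat n U" "\<And>i. i < n \<Longrightarrow> d i > 0" "A = udiag n U d"
    "\<And>t. mpow n A t = udiag n U (\<lambda>i. d i powr t)"
  using assms mpow_udiag unfolding pos_def_def by blast

context fixes A assumes A: "pos_def n A"
begin

lemma pos_def_carrier [simp]: "A \<in> carrier_mat n n"
  using A by (elim pos_defE) simp

lemma pos_def_adjoint [simp]: "mat_adjoint A = A"
  using A by (elim pos_defE) simp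

lemma pos_def_mpow [simp]: "pos_def n (mpow n A t)"
  using A by (elim pos_defE) (simp add: pos_def_udiag less_imp_neq[THEN not_sym])

lemma mpow_add: "mpow n A s * mpow n A t = mpow n A (s + t)"
  using A by (elim pos_defE) (simp add: udiag_mult powr_add)

lemma mpow_zero [simp]: "mpow n A 0 = 1\<^sub>m n"
proof -
  obtain U d where *: "unitary_mat n U" "\<And>i. i < n \<Longrightarrow> d i > 0"
    "\<And>t. mpow n A t = udiag n U (\<lambda>i. d i powr t)" using A by (elim pos_defE) blast
  then have "mpow n A 0 = udiag n U (\<lambda>_. 1)" by (auto
      intro!: udiag_cong simp: less_imp_neq[THEN not_sym])
  then show ?thesis using * by (simp add: udiag_one)
qed

lemma mpow_one [simp]: "mpow n A 1 = A"
  using A by (elim pos_defE) (auto intro!: udiag_cong simp: less_imp_le)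

lemma mpow_mpow: "mpow n (mpow n A s) t = mpow n A (s * t)"
proof -
  obtain U d where *: "unitary_mat n U" "\<And>i. i < n \<Longrightarrow> d i > 0"
    "\<And>t. mpow n A t = udiag n U (\<lambda>i. d i powr t)" using A by (elim pos_defE) blast
  then have "mpow n (mpow n A s) t = udiag n U (\<lambda>i. (d i powr s) powr t)"
    by (simp add: mpow_udiag less_imp_neq[THEN not_sym])
  then show ?thesis by (simp add: * powr_powr)
qed

lemma mpow_smult:
  assumes "a > 0"
  shows "pos_def n (complex_of_real a \<cdot>\<^sub>m A)"
    "mpow n (complex_of_real a \<cdot>\<^sub>m A) t = complex_of_real (a powr t) \<cdot>\<^sub>m mpow n A t"
proof -
  obtain U d where *: "unitary_mat n U" "\<And>i. i < n \<Longrightarrow> d i > 0" "A = udiag n U d"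
    "\<And>t. mpow n A t = udiag n U (\<lambda>i. d i powr t)" using A by (elim pos_defE) blast
  have aA: "complex_of_real a \<cdot>\<^sub>m A = udiag n U (\<lambda>i. a * d i)" using * by (simp add: udiag_smult)
  show "pos_def n (complex_of_real a \<cdot>\<^sub>m A)" using * assms unfolding aA by (simp add: pos_def_udiag)
  have "mpow n (complex_of_real a \<cdot>\<^sub>m A) t = udiag n U (\<lambda>i. (a * d i) powr t)"
    using * assms unfolding aA by (simp add: mpow_udiag)
  also have "\<dots> = udiag n U (\<lambda>i. a powr t * d i powr t)"
    using * assms by (intro udiag_cong) (simp add: powr_mult less_imp_le)
  finally show "mpow n (complex_of_real a \<cdot>\<^sub>m A) t = complex_of_real (a powr t) \<cdot>\<^sub>m mpow n A t"
    using * by (simp add: udiag_smult)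
qed

end

lemma mpow_carrier [simp]: "pos_def n A \<Longrightarrow> mpow n A t \<in> carrier_mat n n"
  by simp

lemma mpow_adjoint [simp]: "pos_def n A \<Longrightarrow> mat_adjoint (mpow n A t) = mpow n A t"
  by simp

lemma mpow_add_left:
  "pos_def n A \<Longrightarrow> X \<in> carrier_mat n n \<Longrightarrow> mpow n A s * (mpow n A t * X) = mpow n A (s + t) * X"
  by (simp add: assoc_square[of _ n, symmetric] mpow_add)

lemma mpow_base_mult:
  assumes "pos_def n A"
  shows "A * mpow n A t = mpow n A (1 + t)" "mpow n A t * A = mpow n A (t + 1)"
    "X \<in> carrier_mat n n \<Longrightarrow> A * (mpow n A t * X) = mpow n A (1 + t) * X"
    "X \<in> carrier_mat n n \<Longrightarrow> mpow n A t * (A * X) = mpow n A (t + 1) * X"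
  using mpow_add[OF assms, of 1 t] mpow_add[OF assms, of t 1]
    mpow_add_left[OF assms, of X 1 t] mpow_add_left[OF assms, of X t 1] assms by auto

lemma mpow_intertwine:
  assumes "pos_def n A" "pos_def n B" "T \<in> carrier_mat n n" "A * T = T * B"
  shows "mpow n A t * T = T * mpow n B t"
proof -
  obtain U d where U: "unitary_mat n U" "A = udiag n U d" "mpow n A t = udiag n U (\<lambda>i. d i powr t)"
    using assms(1) by (elim pos_defE) blast
  obtain V e where V: "unitary_mat n V" "B = udiag n V e" "mpow n B t = udiag n V (\<lambda>i. e i powr t)"
    using assms(2) by (elim pos_defE) blast
  have "udiag n U d * T = T * udiag n V e" using assms(4) by
      (simp only: U(2)[symmetric] V(2)[symmetric])
  from udiag_intertwine[OF U(1) V(1) assms(3) this, of "\<lambda>x. x powr t"]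
  show ?thesis by (simp only: U(3) V(3))
qed

section \<open>Quadratic forms under congruence and in an eigenbasis\<close>

lemma qform_congruence:
  assumes "A \<in> carrier_mat n n" "X \<in> carrier_mat n n" "v \<in> carrier_vec n"
  shows "qform (mat_adjoint X * A * X) v = qform A (X *\<^sub>v v)"
  using assms cscalar_prod_adjoint[of "mat_adjoint X" n n "A *\<^sub>v (X *\<^sub>v v)" v]
  by (simp add: qform_def assoc_mult_mat_vec[of _ n n _ n])

lemma qform_one: "v \<in> carrier_vec n \<Longrightarrow> qform (1\<^sub>m n) v = Re (v \<bullet>c v)"
  by (simp add: qform_def)

lemma qform_gram:
  assumes "X \<in> carrier_mat n n" "v \<in> carrier_vec n"
  shows "qform (mat_adjoint X * X) v = Re ((X *\<^sub>v v) \<bullet>c (X *\<^sub>v v))"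
  using qform_congruence[of "1\<^sub>m n" X v] assms by (simp add: qform_one)

lemma qform_udiag:
  assumes U: "unitary_mat n U" and v: "v \<in> carrier_vec n"
  shows "qform (udiag n U d) v = (\<Sum>i<n. d i * (cmod ((mat_adjoint U *\<^sub>v v) $ i))\<^sup>2)"
proof -
  let ?D = "mat_diag n (\<lambda>i. complex_of_real (d i))"
  define w where "w = mat_adjoint U *\<^sub>v v"
  have w: "w \<in> carrier_vec n" using v unitary_carrier[OF U] by (simp add: w_def)
  have "qform (udiag n U d) v = qform ?D w"
    using qform_congruence[of ?D "mat_adjoint U" v] U v by (simp add: udiag_def w_def)
  also have "(?D *\<^sub>v w) $ i = of_real (d i) * w $ i" if "i < n" for i
  proof -
    have "(?D *\<^sub>v w) $ i = (\<Sum>j<n. (if i = j then of_real (d j) else 0) * w $ j)"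
      using that w by (simp add: mat_diag_def scalar_prod_def atLeast0LessThan)
    also have "\<dots> = (\<Sum>j<n. if i = j then of_real (d j) * w $ j else 0)"
      by (rule sum.cong) auto
    finally have "(?D *\<^sub>v w) $ i = (\<Sum>j<n. if i = j then of_real (d j) * w $ j else 0)" .
    then show ?thesis using that by simp
  qed
  then have "qform ?D w = (\<Sum>i<n. d i * (cmod (w $ i))\<^sup>2)"
  proof -
    assume D: "\<And>i. i < n \<Longrightarrow> (?D *\<^sub>v w) $ i = of_real (d i) * w $ i"
    have "qform ?D w = (\<Sum>i<n. Re ((?D *\<^sub>v w) $ i * cnj (w $ i)))"
      using w by (simp add: qform_def scalar_prod_def atLeast0LessThan)
    also have "\<dots> = (\<Sum>i<n. d i * (cmod (w $ i))\<^sup>2)"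
      by (intro sum.cong refl, subst D, simp, unfold cmod_power2, simp add: power2_eq_square
        algebra_simps)
    finally show ?thesis .
  qed
  finally show ?thesis by (simp add: w_def)
qed

lemma qform_pos:
  assumes "pos_def n A" "v \<in> carrier_vec n" "v \<noteq> 0\<^sub>v n"
  shows "qform A v > 0"
proof -
  obtain U d where *: "unitary_mat n U" "\<And>i. i < n \<Longrightarrow> d i > 0" "A = udiag n U d"
    using assms(1) by (elim pos_defE) blast
  define w where "w = mat_adjoint U *\<^sub>v v"
  have w: "w \<in> carrier_vec n" using assms * by (simp add: w_def)
  have "U *\<^sub>v w = v" using * assms unitary_simps(2)[OF *(1)]
    by (simp add: w_def assoc_mult_mat_vec[of _ n n _ n, symmetric])
  then have "w \<noteq> 0\<^sub>v n" using assms * by auto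
  then obtain i where i: "i < n" "w $ i \<noteq> 0"
    using w eq_vecI[of w "0\<^sub>v n"] by auto
  then have "(\<Sum>i<n. d i * (cmod (w $ i))\<^sup>2) > 0" using *
    by (intro sum_pos2[of _ i]) (auto simp: less_imp_le)
  then show ?thesis using * assms qform_udiag by (simp add: w_def)
qed

end

subsection \<open>The Loewner order\<close>

context fixes n :: nat
begin

text \<open>A first diagonalization only serves to show that the eigenvalues are real. They can then
  be sorted, and \<open>hermitian_diagonalization\<close> is applied again with the sorted list,
  which yields the same characteristic polynomial.\<close>

lemma hermitian_udiag_sorted:
  assumes A: "hermitian_mat n A"
  shows "\<exists>U d. unitary_mat n U \<and> (\<forall>i j. i \<le> j \<and> j < n \<longrightarrow> d j \<le> d i) \<and> A = udiag n U d"
proof -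
  have carr: "A \<in> carrier_mat n n" and adj: "mat_adjoint A = A" using A
      by (auto simp: hermitian_mat_def)
  obtain es where es: "char_poly A = (\<Prod>e\<leftarrow>es. [:- e, 1:])" "length es = n"
    using char_poly_factorized[OF carr] by blast
  obtain U where U: "unitary_mat n U" and AU: "A = U * mat_diag n (\<lambda>i. es ! i) * mat_adjoint U"
    using hermitian_diagonalization[OF A es(1)] by blast
  let ?D = "mat_diag n (\<lambda>i. es ! i)"
  have "?D = mat_adjoint U * A * U" unfolding AU
    using U by (simp add: assoc_square[of _ n] unitary_simps[OF U])
  then have "mat_adjoint ?D = ?D"
    using U by (simp add: adjoint_mult_square[of _ n] assoc_square[of _ n] adj carr)
  then have "cnj (es ! i) = es ! i" if "i < n" for i
  proof -
    have "mat_adjoint ?D $$ (i,i) = ?D $$ (i,i)" using \<open>mat_adjoint ?D = ?D\<close> by simp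
    then show ?thesis using that by (simp add: mat_adjoint_diag mat_diag_def)
  qed
  then have re: "complex_of_real (Re (es ! i)) = es ! i" if "i < n" for i
    using that by (metis Reals_cnj_iff of_real_Re)
  define rs where "rs = rev (sort (map Re es))"
  have len: "length rs = n" by (simp add: rs_def es)
  have map_es: "map complex_of_real (map Re es) = es"
    by (rule nth_equalityI) (auto simp: re es(2))
  have "mset rs = mset (map Re es)" by (simp add: rs_def)
  then have "mset (map complex_of_real rs) = mset (map complex_of_real (map Re es))"
    by (simp only: mset_map[of complex_of_real])
  then have ms: "mset (map complex_of_real rs) = mset es" unfolding map_es .
  have "(\<Prod>e\<leftarrow>map complex_of_real rs. [:- e, 1:])
      = prod_mset (image_mset (\<lambda>e. [:- e, 1:]) (mset (map complex_of_real rs)))"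
    by (simp only: prod_mset_prod_list mset_map[symmetric])
  also have "\<dots> = (\<Prod>e\<leftarrow>es. [:- e, 1:])"
    by (simp only: ms prod_mset_prod_list mset_map[symmetric])
  finally have "char_poly A = (\<Prod>e\<leftarrow>map complex_of_real rs. [:- e, 1:])" using es(1) by simp
  from hermitian_diagonalization[OF A this] obtain V where V: "unitary_mat n V"
    and AV: "A = V * mat_diag n (\<lambda>i. map complex_of_real rs ! i) * mat_adjoint V" by blast
  have "mat_diag n (\<lambda>i. map complex_of_real rs ! i) = mat_diag n (\<lambda>i. complex_of_real (rs ! i))"
    by (rule mat_diag_cong) (simp add: len)
  then have "A = udiag n V (\<lambda>i. rs ! i)" using AV by (simp add: udiag_def)
  moreover have "rs ! j \<le> rs ! i" if "i \<le> j" "j < n" for i j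
    using that len unfolding rs_def by (auto simp: rev_nth intro!: sorted_nth_mono)
  ultimately show ?thesis using V by blast
qed

lemma eigenvalue_qform:
  assumes U: "unitary_mat n U" and i: "i < n"
  shows "col U i \<noteq> 0\<^sub>v n" "udiag n U d *\<^sub>v col U i = complex_of_real (d i) \<cdot>\<^sub>v col U i"
    "qform (udiag n U d) (col U i) = d i"
proof -
  note c [simp] = unitary_carrier[OF U]
  have "mat_adjoint U *\<^sub>v col U i = col (mat_adjoint U * U) i"
    using i by (intro col_mult2[symmetric, of _ n n _ n]) auto
  then have e: "mat_adjoint U *\<^sub>v col U i = unit_vec n i" using i by (simp add: unitary_simps[OF U])
  then show "col U i \<noteq> 0\<^sub>v n"
    using i mult_mat_vec_zero[OF mat_adjoint_carrier[OF c]] unit_vec_nonzero[OF i, where ?'a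
      = complex]
    by (metis (no_types))
  have "udiag n U d *\<^sub>v col U i = U *\<^sub>v (mat_diag n (\<lambda>i. complex_of_real (d i)) *\<^sub>v unit_vec n i)"
    using i by (simp add: udiag_def assoc_mult_mat_vec[of _ n n _ n] e)
  also have "mat_diag n (\<lambda>i. complex_of_real (d i)) *\<^sub>v unit_vec n i
      = complex_of_real (d i) \<cdot>\<^sub>v unit_vec n i"
    using i by (intro eq_vecI) (auto simp: mat_diag_def)
  also have "U *\<^sub>v \<dots> = complex_of_real (d i) \<cdot>\<^sub>v col U i"
  proof -
    have "U *\<^sub>v unit_vec n i = col U i"
      using i by (intro eq_vecI) (auto simp: carrier_matD[OF c])
    then show ?thesis using i by (simp add: mult_mat_vec[of _ n n])
  qed
  finally show "udiag n U d *\<^sub>v col U i = complex_of_real (d i) \<cdot>\<^sub>v col U i" .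
  have "qform (udiag n U d) (col U i) = (\<Sum>j<n. d j * (cmod (unit_vec n i $ j))\<^sup>2)"
    using qform_udiag[OF U, of "col U i" d] i e by simp
  also have "\<dots> = (\<Sum>j<n. if i = j then d j else 0)"
    using i by (intro sum.cong) auto
  finally show "qform (udiag n U d) (col U i) = d i" using i by simp
qed

text \<open>Every eigenvalue is the value of the quadratic form at its eigenvector
  \<open>col U i\<close>, hence positive.\<close>

lemma pos_def_sorted:
  assumes A: "hermitian_mat n A" and pos: "\<And>v. v \<in> carrier_vec n \<Longrightarrow> v \<noteq> 0\<^sub>v n \<Longrightarrow> qform A v > 0"
  shows "\<exists>U d. unitary_mat n U \<and> (\<forall>i<n. d i > 0) \<and> (\<forall>i j. i \<le> j \<and> j < n \<longrightarrow> d j \<le> d i) \<and> A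
    = udiag n U d"
proof -
  obtain U d where *: "unitary_mat n U" "\<forall>i j. i \<le> j \<and> j < n \<longrightarrow> d j \<le> d i" "A = udiag n U d"
    using hermitian_udiag_sorted[OF A] by blast
  have "d i > 0" if "i < n" for i
    using eigenvalue_qform(1)[OF *(1) that] eigenvalue_qform(3)[OF *(1) that, of d] pos[of "col U
      i"] *(3) that unitary_carrier[OF *(1)] by simp
  then show ?thesis using * by blast
qed

text \<open>The left inverse \<open>Y\<close> makes \<open>X\<close> injective, so the form of
  \<open>A\<close> is evaluated at a nonzero vector.\<close>

lemma pos_def_congruence:
  assumes A: "pos_def n A" and X: "X \<in> carrier_mat n n" "Y \<in> carrier_mat n n" "Y * X = 1\<^sub>m n"
  shows "pos_def n (mat_adjoint X * A * X)"
proof -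
  have "hermitian_mat n (mat_adjoint X * A * X)"
    using A X by (simp add: hermitian_mat_def adjoint_mult_square[of _ n] assoc_square[of _ n])
  moreover have "qform (mat_adjoint X * A * X) v > 0" if v: "v \<in> carrier_vec n" "v \<noteq> 0\<^sub>v n" for v
  proof -
    have "Y *\<^sub>v (X *\<^sub>v v) = v" using v X by (simp add: assoc_mult_mat_vec[of _ n n _ n, symmetric])
    then have "X *\<^sub>v v \<noteq> 0\<^sub>v n" using v X by auto
    then show ?thesis using qform_pos[OF A, of "X *\<^sub>v v"] X v A
      by (simp add: qform_congruence[of _ n])
  qed
  ultimately obtain U d where "unitary_mat n U" "\<forall>i<n. d i > 0" "mat_adjoint X * A * X
      = udiag n U d"
    using pos_def_sorted by metis
  then show ?thesis by (auto simp: pos_def_def)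
qed

lemma pos_def_mpow_congruence:
  assumes "pos_def n A" "pos_def n B"
  shows "pos_def n (mpow n B t * A * mpow n B t)"
  using pos_def_congruence[OF assms(1), of "mpow n B t" "mpow n B (-t)"] assms
  by (simp add: mpow_add)

lemma mat_le_trans: "mat_le n A B \<Longrightarrow> mat_le n B C \<Longrightarrow> mat_le n A C"
  unfolding mat_le_def by (meson order_trans)

lemma mat_le_congruence:
  assumes "mat_le n A B" "A \<in> carrier_mat n n" "B \<in> carrier_mat n n" "X \<in> carrier_mat n n"
  shows "mat_le n (mat_adjoint X * A * X) (mat_adjoint X * B * X)"
  using assms by (auto simp: mat_le_def qform_congruence[of _ n])

lemma mat_le_mpow_congruence:
  assumes "mat_le n A B" "A \<in> carrier_mat n n" "B \<in> carrier_mat n n" "pos_def n P"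
  shows "mat_le n (mpow n P t * A * mpow n P t) (mpow n P t * B * mpow n P t)"
  using mat_le_congruence[OF assms(1-3), of "mpow n P t"] assms by simp

text \<open>This translates between operator inequalities and eigenvalue bounds. One direction tests
  the inequality on the columns of \<open>U\<close>, the other compares with the identity written as
  \<open>udiag n U (\<lambda>_. 1)\<close>.\<close>

lemma mat_le_one_iff:
  assumes "unitary_mat n U"
  shows "mat_le n (udiag n U d) (1\<^sub>m n) \<longleftrightarrow> (\<forall>i<n. d i \<le> 1)"
proof
  assume le: "mat_le n (udiag n U d) (1\<^sub>m n)"
  show "\<forall>i<n. d i \<le> 1"
  proof (intro allI impI)
    fix i assume i: "i < n"
    have "d i = qform (udiag n U d) (col U i)" using eigenvalue_qform[OF assms i] by simp
    also have "\<dots> \<le> qform (1\<^sub>m n) (col U i)"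
      using le unitary_carrier[OF assms] col_dim[of U i] carrier_vecI[of "col U i" n]
        by (auto simp: mat_le_def)
    also have "\<dots> = qform (udiag n U (\<lambda>_. 1)) (col U i)" using udiag_one[OF assms] by simp
    also have "\<dots> = 1" using eigenvalue_qform[OF assms i] by simp
    finally show "d i \<le> 1" .
  qed
next
  assume d: "\<forall>i<n. d i \<le> 1"
  have "d i * x \<le> 1 * x" if "i < n" "x \<ge> 0" for i x
    using d that by (intro mult_right_mono) auto
  then have "mat_le n (udiag n U d) (udiag n U (\<lambda>_. 1))"
    unfolding mat_le_def by (auto simp only: qform_udiag[OF assms] intro!: sum_mono) simp
  then show "mat_le n (udiag n U d) (1\<^sub>m n)" by (simp add: udiag_one[OF assms])
qed

text \<open>Expand \<open>0 \<le> |v - T T\<^sup>* v|\<^sup>2\<close>.\<close>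

lemma contraction_adjoint:
  assumes T: "T \<in> carrier_mat n n" and le: "mat_le n (mat_adjoint T * T) (1\<^sub>m n)"
  shows "mat_le n (T * mat_adjoint T) (1\<^sub>m n)"
  unfolding mat_le_def
proof
  fix v :: "complex vec" assume v: "v \<in> carrier_vec n"
  define w where "w = mat_adjoint T *\<^sub>v v"
  define u where "u = T *\<^sub>v w"
  have c: "w \<in> carrier_vec n" "u \<in> carrier_vec n" using T v by (auto simp: w_def u_def)
  have 1: "Re (u \<bullet>c u) \<le> Re (w \<bullet>c w)"
    using le c T by (simp add: mat_le_def qform_gram[of _ n] qform_one u_def)
  have 2: "u \<bullet>c v = w \<bullet>c w"
    using cscalar_prod_adjoint[OF T c(1) v] by (simp add: u_def w_def)
  have "Re ((v - u) \<bullet>c (v - u)) = Re (v \<bullet>c v) - 2 * Re (u \<bullet>c v) + Re (u \<bullet>c u)"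
  proof -
    have "Re ((v - u) \<bullet>c (v - u)) = (\<Sum>i<n. Re ((v $ i - u $ i) * cnj (v $ i - u $ i)))"
      using v c by (simp add: scalar_prod_def atLeast0LessThan)
    also have "\<dots> = (\<Sum>i<n. Re (v $ i * cnj (v $ i)) - 2 * Re (u $ i * cnj (v $ i)) + Re (u $ i * cnj
        (u $ i)))"
      by (intro sum.cong) (auto simp: algebra_simps)
    also have "\<dots> = Re (v \<bullet>c v) - 2 * Re (u \<bullet>c v) + Re (u \<bullet>c u)"
      unfolding sum.distrib sum_subtractf sum_distrib_left[symmetric]
      using v c by (simp add: scalar_prod_def atLeast0LessThan)
    finally show ?thesis .
  qed
  moreover have "Re ((v - u) \<bullet>c (v - u)) \<ge> 0" by (simp add: cscalar_prod_self sum_nonneg)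
  \<comment> \<open>By \<open>2\<close> the cross term is \<open>|w|^2\<close>, so
    \<open>0 <= |v|^2 - 2 |w|^2 + |u|^2\<close>, and \<open>1\<close> bounds the last term by
    \<open>|w|^2\<close>.\<close>
  ultimately have "Re (w \<bullet>c w) \<le> Re (v \<bullet>c v)" using 1 2 by simp
  then show "qform (T * mat_adjoint T) v \<le> qform (1\<^sub>m n) v"
    using qform_gram[of "mat_adjoint T" n v] T v by (simp add: qform_one w_def)
qed

text \<open>Conjugating \<open>A <= B\<close> by \<open>B^(-1/2)\<close> says that
  \<open>T = A^(1/2) B^(-1/2)\<close> is a contraction. Then so is its adjoint, that is
  \<open>A^(1/2) B^(-1) A^(1/2) <= 1\<close>, and conjugating by \<open>A^(-1/2)\<close>
  finishes.\<close>

lemma mpow_inverse_antimono: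
  assumes A: "pos_def n A" and B: "pos_def n B" and le: "mat_le n A B"
  shows "mat_le n (mpow n B (-1)) (mpow n A (-1))"
proof -
  note [simp] = pos_def_carrier[OF A] pos_def_carrier[OF B]
  define T where "T = mpow n A (1/2) * mpow n B (-1/2)"
  have T: "T \<in> carrier_mat n n" using A B by (simp add: T_def)
  have aT: "mat_adjoint T = mpow n B (-1/2) * mpow n A (1/2)"
    using A B by (simp add: T_def adjoint_mult_square[of _ n])
  have "mat_adjoint T * T = mpow n B (-1/2) * A * mpow n B (-1/2)"
    using A B by (simp add: aT, simp add: T_def assoc_square[of _ n] mpow_add_left)
  moreover have "1\<^sub>m n = mpow n B (-1/2) * B * mpow n B (-1/2)"
    using B by (simp add: assoc_square[of _ n] mpow_base_mult mpow_add)
  ultimately have "mat_le n (mat_adjoint T * T) (1\<^sub>m n)"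
    using mat_le_mpow_congruence[OF le _ _ B] by simp
  then have "mat_le n (T * mat_adjoint T) (1\<^sub>m n)" by (rule contraction_adjoint[OF T])
  from mat_le_mpow_congruence[OF this _ _ A, of "-1/2"]
  show ?thesis using A B T
    by (simp add: aT, simp add: T_def assoc_square[of _ n] mpow_add_left mpow_add)
qed

text \<open>An eigenvector \<open>u\<close> of \<open>M\<close> is carried by \<open>G\<close> to an
  eigenvector of \<open>X\<close> with the same eigenvalue, and a contraction cannot lengthen it.
  Passing through eigenvectors matters because \<open>X\<close> need not be Hermitian.\<close>

lemma similar_contraction:
  assumes M: "pos_def n M" and X: "X \<in> carrier_mat n n"
    and G: "G \<in> carrier_mat n n" "G' \<in> carrier_mat n n"
    and inv: "G' * G = 1\<^sub>m n" and sim: "X * G = G * M"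
    and le: "mat_le n (mat_adjoint X * X) (1\<^sub>m n)"
  shows "mat_le n M (1\<^sub>m n)"
proof -
  obtain U d where U: "unitary_mat n U" and d: "\<And>i. i < n \<Longrightarrow> d i > 0" and MU: "M = udiag n U d"
    using M by (elim pos_defE) blast
  have "d i \<le> 1" if i: "i < n" for i
  proof -
    define u where "u = col U i"
    have u: "u \<in> carrier_vec n" using col_dim[of U i] carrier_matD[OF unitary_carrier[OF U]] by
        (simp add: u_def)
    have Mu: "M *\<^sub>v u = complex_of_real (d i) \<cdot>\<^sub>v u" and u0: "u \<noteq> 0\<^sub>v n"
      using eigenvalue_qform[OF U i] by (auto simp: MU u_def)
    define w where "w = G *\<^sub>v u"
    have w: "w \<in> carrier_vec n" using G u by (simp add: w_def)
    have "G' *\<^sub>v w = u" using G u inv by (simp add: w_def assoc_mult_mat_vec[of _ n n _ n,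
        symmetric])
    then have "w \<noteq> 0\<^sub>v n" using G u0 by auto
    then have pos: "Re (w \<bullet>c w) > 0" using w cscalar_prod_self_pos by blast
    have "X *\<^sub>v w = (X * G) *\<^sub>v u" using X G u by (simp add: w_def assoc_mult_mat_vec[of _ n n _ n])
    also have "\<dots> = G *\<^sub>v (M *\<^sub>v u)" using G u M by (simp add: sim assoc_mult_mat_vec[of _ n n _ n])
    also have "\<dots> = complex_of_real (d i) \<cdot>\<^sub>v w" using G u by
        (simp add: Mu w_def mult_mat_vec[of _ n n])
    finally have Xw: "X *\<^sub>v w = complex_of_real (d i) \<cdot>\<^sub>v w" .
    have "Re ((X *\<^sub>v w) \<bullet>c (X *\<^sub>v w)) \<le> Re (w \<bullet>c w)"
      using le w X by (simp add: mat_le_def qform_gram[of _ n] qform_one)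
    moreover have "Re ((X *\<^sub>v w) \<bullet>c (X *\<^sub>v w)) = (d i)\<^sup>2 * Re (w \<bullet>c w)"
      using w by (simp add: Xw conjugate_smult_vec power2_eq_square)
    ultimately have "(d i)\<^sup>2 \<le> 1" using pos by simp
    then show ?thesis using d[OF i] by (simp add: power_le_one_iff abs_square_le_1)
  qed
  then show ?thesis unfolding MU by (simp add: mat_le_one_iff[OF U])
qed

text \<open>Pedersen: with \<open>c = (a + b) / 2\<close>, the matrix \<open>B\<^bsup>-c/2\<^esup> A\<^bsup>c\<^esup> B\<^bsup>-c/2\<^esup>\<close> is similar to a product of
  two contractions, so its eigenvalues are at most 1.\<close>

lemma Loewner_Heinz_midpoint:
  assumes A: "pos_def n A" and B: "pos_def n B"
    and a: "mat_le n (mpow n A a) (mpow n B a)" and b: "mat_le n (mpow n A b) (mpow n B b)"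
  shows "mat_le n (mpow n A ((a + b) / 2)) (mpow n B ((a + b) / 2))"
proof -
  define c where "c = (a + b) / 2"
  \<comment> \<open>If \<open>A^r <= B^r\<close>, then \<open>T r\<close> is a contraction
    (\<open>contr\<close>), by conjugation with \<open>B^(-r/2)\<close>.\<close>
  define T where "T = (\<lambda>r. mpow n A (r/2) * mpow n B (-r/2))"
  have T: "T r \<in> carrier_mat n n" for r using A B by (simp add: T_def)
  have aT: "mat_adjoint (T r) = mpow n B (-r/2) * mpow n A (r/2)" for r
    using A B by (simp add: T_def adjoint_mult_square[of _ n])
  have TT: "mat_adjoint (T r) * T r = mpow n B (-r/2) * mpow n A r * mpow n B (-r/2)" for r
    using A B by (simp add: aT, simp add: T_def assoc_square[of _ n] mpow_add_left)
  have contr: "mat_le n (mat_adjoint (T r) * T r) (1\<^sub>m n)"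
    if "mat_le n (mpow n A r) (mpow n B r)" for r
    using mat_le_mpow_congruence[OF that _ _ B, of "-r/2"] A B
    by (simp add: TT assoc_square[of _ n] mpow_add)
  define X where "X = mat_adjoint (T a) * T b"
  have X: "X \<in> carrier_mat n n" using T by (simp add: X_def)
  have "mat_le n (mat_adjoint (T b) * (T a * mat_adjoint (T a)) * T b) (mat_adjoint (T b) * 1\<^sub>m n *
      T b)"
    using T by (intro mat_le_congruence contraction_adjoint contr a) auto
  then have "mat_le n (mat_adjoint X * X) (mat_adjoint (T b) * T b)"
    using T by (simp add: X_def adjoint_mult_square[of _ n] assoc_square[of _ n])
  then have XX: "mat_le n (mat_adjoint X * X) (1\<^sub>m n)"
    using contr[OF b] by (rule mat_le_trans)
  define M where "M = mpow n B (-c/2) * mpow n A c * mpow n B (-c/2)"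
  \<comment> \<open>Since \<open>a/2 + b/2 = c\<close>, \<open>X\<close> is
    \<open>B^(-a/2) A^c B^(-b/2)\<close>. Conjugation by this power of \<open>B\<close> balances the
    outer exponents to \<open>-c/2\<close> each, which gives the Hermitian matrix
    \<open>M\<close>.\<close>
  define G where "G = mpow n B ((c - a) / 2)"
  have "pos_def n M" unfolding M_def using A B by (intro pos_def_mpow_congruence) auto
  moreover have "X * G = G * M"
  proof -
    have e: "a / 2 + b / 2 = c" "- (b / 2) + (c - a) / 2 = - (c / 2)" "(c - a) / 2 + - (c / 2)
        = - (a / 2)"
      "(c - a) / 2 - c / 2 = - (a / 2)" "(c - a) / 2 - b / 2 = - (c / 2)"
      by (simp_all add: c_def field_simps)
    show ?thesis
      using A B by (simp add: X_def M_def G_def aT, simp add: T_def assoc_square[of _ n]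
        mpow_add_left mpow_add e)
  qed
  moreover have "mpow n B (-((c - a) / 2)) * G = 1\<^sub>m n" using B by (simp add: G_def mpow_add)
  ultimately have "mat_le n M (1\<^sub>m n)"
    using X B XX by (intro similar_contraction[of M X G "mpow n B (-((c - a) / 2))"]) (auto simp:
      G_def)
  from mat_le_mpow_congruence[OF this _ _ B, of "c/2"]
  show ?thesis using A B
    by (simp add: M_def assoc_square[of _ n] mpow_add_left mpow_add c_def[symmetric])
qed

lemma continuous_qform_mpow:
  assumes A: "pos_def n A" and v: "v \<in> carrier_vec n"
  shows "continuous_on UNIV (\<lambda>r. qform (mpow n A r) v)"
proof -
  obtain U d where U: "unitary_mat n U" "\<And>i. i < n \<Longrightarrow> d i > 0"
    "\<And>t. mpow n A t = udiag n U (\<lambda>i. d i powr t)" using A by (elim pos_defE) blast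
  show ?thesis unfolding U(3) qform_udiag[OF U(1) v]
    using U(2) by (intro continuous_intros) (auto simp: less_imp_neq[THEN not_sym])
qed

text \<open>The admissible exponents form a closed set that contains 0, 1 and all midpoints.\<close>

lemma Loewner_Heinz:
  assumes A: "pos_def n A" and B: "pos_def n B" and le: "mat_le n A B" and r: "0 \<le> r" "r \<le> 1"
  shows "mat_le n (mpow n A r) (mpow n B r)"
proof (rule ccontr)
  assume neg: "\<not> mat_le n (mpow n A r) (mpow n B r)"
  define E where "E = {r. mat_le n (mpow n A r) (mpow n B r)}"
  \<comment> \<open>For each fixed vector both forms are continuous in the exponent, so
    \<open>E\<close> is an intersection of closed sets.\<close>
  have "E = (\<Inter>v\<in>carrier_vec n. {r. qform (mpow n A r) v \<le> qform (mpow n B r) v})"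
    by (auto simp: E_def mat_le_def)
  also have "closed \<dots>"
    by (intro closed_INT ballI closed_Collect_le continuous_qform_mpow A B)
  finally have E: "closed E" .
  have mid: "(a + b) / 2 \<in> E" if "a \<in> E" "b \<in> E" for a b
    using that Loewner_Heinz_midpoint[OF A B] by (auto simp: E_def)
  have 01: "0 \<in> E" "1 \<in> E" using A B le by (auto simp: E_def mat_le_def)
  \<comment> \<open>\<open>a\<close> and \<open>b\<close> are the admissible exponents nearest to
    \<open>r\<close> from below and from above; they exist because \<open>E\<close> is closed and
    contains 0 and 1. Their midpoint is admissible and strictly between them, which contradicts one
    of the two extremal choices.\<close>
  define a where "a = Sup (E \<inter> {0..r})"
  define b where "b = Inf (E \<inter> {r..1})"
  have a: "a \<in> E \<inter> {0..r}" unfolding a_def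
    using 01 r E by (intro closed_contains_Sup) (auto intro!: closed_Int)
  have b: "b \<in> E \<inter> {r..1}" unfolding b_def
    using 01 r E by (intro closed_contains_Inf) (auto intro!: closed_Int)
  have ne: "a < r" "r < b" using a b neg by (auto simp: E_def order.order_iff_strict)
  define m where "m = (a + b) / 2"
  have m: "m \<in> E" "a < m" "m < b" using mid a b ne by (auto simp: m_def)
  show False
  proof (cases "m \<le> r")
    case True
    then have "m \<le> a" unfolding a_def using m a by (intro cSup_upper) auto
    then show False using m by simp
  next
    case False
    then have "b \<le> m" unfolding b_def using m b by (intro cInf_lower) auto
    then show False using m by simp
  qed
qed

section \<open>The operator inequality behind the theorem\<close>

lemma mpow_gram:
  assumes T: "T \<in> carrier_mat n n" and "pos_def n (T * mat_adjoint T)" "pos_def n (mat_adjoint T *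
    T)"
  shows "mpow n (T * mat_adjoint T) (1 + s) = T * mpow n (mat_adjoint T * T) s * mat_adjoint T"
proof -
  have "mpow n (T * mat_adjoint T) (1 + s) = mpow n (T * mat_adjoint T) s * (T * mat_adjoint T)"
    using assms by (simp add: mpow_base_mult add.commute)
  also have "\<dots> = (mpow n (T * mat_adjoint T) s * T) * mat_adjoint T"
    using assms by (simp add: assoc_square[of _ n])
  \<comment> \<open>\<open>T T*\<close> times \<open>T\<close> is \<open>T\<close> times
    \<open>T* T\<close>, so \<open>T\<close> intertwines the two matrices and hence their
    powers.\<close>
  also have "mpow n (T * mat_adjoint T) s * T = T * mpow n (mat_adjoint T * T) s"
    using assms by (intro mpow_intertwine) (auto simp: assoc_square[of _ n])
  finally show ?thesis .
qed

text \<open>The normalized case of the comparison of largest eigenvalues. It will be applied to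
  compounds of \<open>A\<close> and \<open>B\<close>, with the second one rescaled so that the
  hypothesis holds.\<close>

lemma geo_mean_le_one:
  assumes A: "pos_def n A" and B: "pos_def n B" and t: "1 \<le> t" "t \<le> 2"
    and le: "mat_le n (geo_mean n A t B) (1\<^sub>m n)"
  shows "mat_le n (mpow n A ((1 - t) / 2) * mpow n B t * mpow n A ((1 - t) / 2)) (1\<^sub>m n)"
proof -
  define s where "s = t - 1"
  \<comment> \<open>The range of \<open>t\<close> is exactly what makes both \<open>s\<close> and
    \<open>1 - s\<close> admissible Loewner-Heinz exponents.\<close>
  have s: "0 \<le> s" "s \<le> 1" "t = 1 + s" using t by (auto simp: s_def)
  note [simp] = pos_def_carrier[OF A] pos_def_carrier[OF B]
  define C where "C = mpow n A (-1/2) * B * mpow n A (-1/2)"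
  have C: "pos_def n C" unfolding C_def by (rule pos_def_mpow_congruence[OF B A])
  note [simp] = pos_def_carrier[OF C]
  have BC: "B = mpow n A (1/2) * C * mpow n A (1/2)"
    using A by (simp add: C_def assoc_square[of _ n] mpow_add_left mpow_add)
  have gm: "geo_mean n A t B = mpow n A (1/2) * mpow n C (1 + s) * mpow n A (1/2)"
    by (simp only: geo_mean_def C_def s(3))
  have le1: "mat_le n (mpow n C (1 + s)) (mpow n A (-1))"
    using mat_le_mpow_congruence[OF le[unfolded gm] _ _ A, of "-1/2"] A C
    by (simp add: gm assoc_square[of _ n] mpow_add_left mpow_add)
  have "mat_le n A (mpow n C (- (1 + s)))"
    using mpow_inverse_antimono[OF _ _ le1] A C by (simp add: mpow_mpow)
  \<comment> \<open>On the right the exponents add up to \<open>1/2 - (1 + s) + 1/2 = -s\<close>; on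
    the left appears \<open>T* T\<close> for the \<open>T\<close> defined below.\<close>
  from mat_le_mpow_congruence[OF this _ _ C, of "1/2"]
  have "mat_le n (mpow n C (1/2) * A * mpow n C (1/2)) (mpow n C (- s))"
    using A C by (simp add: assoc_square[of _ n] mpow_add)
  from Loewner_Heinz[OF _ _ this s(1,2)]
  have le2: "mat_le n (mpow n (mpow n C (1/2) * A * mpow n C (1/2)) s) (mpow n C (- (s * s)))"
    using A C by (simp add: pos_def_mpow_congruence mpow_mpow)
  define T where "T = mpow n A (1/2) * mpow n C (1/2)"
  have T: "T \<in> carrier_mat n n" using A C by (simp add: T_def)
  have aT: "mat_adjoint T = mpow n C (1/2) * mpow n A (1/2)"
    using A C by (simp add: T_def adjoint_mult_square[of _ n])
  have TT: "T * mat_adjoint T = B" "mat_adjoint T * T = mpow n C (1/2) * A * mpow n C (1/2)"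
    unfolding aT unfolding T_def BC using A C by
      (simp_all add: assoc_square[of _ n] mpow_add_left mpow_add)
  have "mpow n B (1 + s) = T * mpow n (mpow n C (1/2) * A * mpow n C (1/2)) s * mat_adjoint T"
    using mpow_gram[OF T] B pos_def_mpow_congruence[OF A C] by (simp add: TT)
  moreover have "T * mpow n C (- (s * s)) * mat_adjoint T
      = mpow n A (1/2) * mpow n C (1 - s * s) * mpow n A (1/2)"
    using A C by (simp add: aT, simp add: T_def assoc_square[of _ n] mpow_add_left mpow_add)
  ultimately have le3: "mat_le n (mpow n B (1 + s)) (mpow n A (1/2) * mpow n C (1 - s * s) * mpow n
      A (1/2))"
    using mat_le_congruence[OF le2 _ _ mat_adjoint_carrier[OF T]] A C pos_def_mpow_congruence[OF A
      C]
    by simp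
  \<comment> \<open>Raising \<open>le1\<close> to the power \<open>1 - s\<close> turns
    \<open>C^(1+s)\<close> into \<open>C^(1-s*s)\<close>, precisely the middle factor left in
    \<open>le3\<close>.\<close>
  have "mat_le n (mpow n (mpow n C (1 + s)) (1 - s)) (mpow n (mpow n A (-1)) (1 - s))"
    using s by (intro Loewner_Heinz le1) (auto simp: A C)
  then have "mat_le n (mpow n C (1 - s * s)) (mpow n A (s - 1))"
    using A C by (simp add: mpow_mpow algebra_simps)
  from mat_le_mpow_congruence[OF this _ _ A, of "1/2"]
  have "mat_le n (mpow n A (1/2) * mpow n C (1 - s * s) * mpow n A (1/2)) (mpow n A s)"
    using A C by (simp add: assoc_square[of _ n] mpow_add)
  with le3 have "mat_le n (mpow n B (1 + s)) (mpow n A s)" by (rule mat_le_trans)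
  from mat_le_mpow_congruence[OF this _ _ A, of "-s/2"]
  show ?thesis using A B by (simp add: s(3) assoc_square[of _ n] mpow_add)
qed

end

subsection \<open>Compound matrices\<close>

lemma det_mat:
  "det (mat k k f) = (\<Sum>p | p permutes {0..<k}. signof p * (\<Prod>i = 0..<k. f (i, p i)))"
  unfolding det_def
  by (auto intro!: sum.cong prod.cong simp: permutes_in_image[of _ "{0..<k}", simplified])

text \<open>Expand the determinant over all maps \<open>h\<close> from rows to summation indices. A
  map that is not injective gives a minor of \<open>b\<close> with two equal rows. The injective
  ones are grouped by their image \<open>S\<close>, and each is the enumeration \<open>e S\<close>
  composed with a permutation. Any enumeration will do, since a change of order affects both minors
  by the same sign.\<close>

lemma Cauchy_Binet:
  fixes a b :: "nat \<Rightarrow> nat \<Rightarrow> 'a :: comm_ring_1"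
  assumes e: "\<And>S. S \<subseteq> {0..<n} \<Longrightarrow> card S = k \<Longrightarrow> bij_betw (e S) {0..<k} S"
  shows "det (mat k k (\<lambda>(i,j). \<Sum>l = 0..<n. a i l * b l j))
    = (\<Sum>S | S \<subseteq> {0..<n} \<and> card S = k.
        det (mat k k (\<lambda>(i,j). a i (e S j))) * det (mat k k (\<lambda>(i,j). b (e S i) j)))"
proof -
  let ?K = "{0..<k}"
  let ?P = "{p. p permutes ?K}"
  let ?SS = "{S. S \<subseteq> {0..<n} \<and> card S = k}"
  let ?H = "PiE ?K (\<lambda>_. {0..<n})"
  let ?D = "\<lambda>h. det (mat k k (\<lambda>(i,j). b (h i) j))"
  have fin: "finite ?H" by (intro finite_PiE) auto
  have "det (mat k k (\<lambda>(i,j). \<Sum>l = 0..<n. a i l * b l j))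
      = (\<Sum>p\<in>?P. signof p * (\<Sum>h\<in>?H. \<Prod>i\<in>?K. a i (h i) * b (h i) (p i)))"
    unfolding det_mat split by (subst prod_sum_PiE) auto
  also have "\<dots> = (\<Sum>p\<in>?P. \<Sum>h\<in>?H. (\<Prod>i\<in>?K. a i (h i)) * (signof p * (\<Prod>i\<in>?K. b (h i) (p i))))"
    by (simp add: sum_distrib_left prod.distrib mult_ac)
  also have "\<dots> = (\<Sum>h\<in>?H. \<Sum>p\<in>?P. (\<Prod>i\<in>?K. a i (h i)) * (signof p * (\<Prod>i\<in>?K. b (h i) (p i))))"
    by (rule sum.swap)
  also have "\<dots> = (\<Sum>h\<in>?H. (\<Prod>i\<in>?K. a i (h i)) * ?D h)"
    by (simp add: sum_distrib_left det_mat)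
  also have "\<dots> = (\<Sum>h\<in>{h \<in> ?H. inj_on h ?K}. (\<Prod>i\<in>?K. a i (h i)) * ?D h)"
  proof (rule sum.mono_neutral_right[OF fin])
    show "\<forall>h\<in>?H - {h \<in> ?H. inj_on h ?K}. (\<Prod>i\<in>?K. a i (h i)) * ?D h = 0"
    proof
      fix h assume "h \<in> ?H - {h \<in> ?H. inj_on h ?K}"
      then obtain x y where xy: "x < k" "y < k" "x \<noteq> y" "h x = h y" by (auto simp: inj_on_def)
      have "?D h = 0"
        by (rule det_identical_rows[of _ k x y]) (use xy in \<open>auto intro!: eq_vecI\<close>)
      then show "(\<Prod>i\<in>?K. a i (h i)) * ?D h = 0" by simp
    qed
  qed auto
  also have "\<dots> = (\<Sum>S\<in>?SS. \<Sum>h\<in>{h \<in> {h \<in> ?H. inj_on h ?K}. h ` ?K = S}. (\<Prod>i\<in>?K. a i (h i)) * ?D h)"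
  proof (rule sum.group[symmetric])
    show "(\<lambda>h. h ` ?K) ` {h \<in> ?H. inj_on h ?K} \<subseteq> ?SS" by (auto simp: card_image)
  qed (use fin in auto)
  also have "\<dots> = (\<Sum>S\<in>?SS. det (mat k k (\<lambda>(i,j). a i (e S j))) * ?D (e S))"
  proof (rule sum.cong[OF refl])
    fix S assume "S \<in> ?SS"
    then have S: "S \<subseteq> {0..<n}" "card S = k" by auto
    have bij: "bij_betw (e S) ?K S" by (rule e[OF S])
    then have einj: "inj_on (e S) ?K" and eim: "e S ` ?K = S" by (auto simp: bij_betw_def)
    \<comment> \<open>These are mutually inverse bijections between permutations and injective maps
      with image \<open>S\<close>. \<open>?g\<close> restricts because members of \<open>?H\<close>
      are extensional; \<open>?inv\<close> is the identity beyond \<open>k\<close> because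
      \<open>permutes\<close> demands it.\<close>
    let ?g = "\<lambda>p. restrict (e S \<circ> p) ?K"
    let ?inv = "\<lambda>h i. if i < k then inv_into ?K (e S) (h i) else i"
    have "(\<Sum>h\<in>{h \<in> {h \<in> ?H. inj_on h ?K}. h ` ?K = S}. (\<Prod>i\<in>?K. a i (h i)) * ?D h)
        = (\<Sum>p\<in>?P. (\<Prod>i\<in>?K. a i (?g p i)) * ?D (?g p))"
    proof (rule sum.reindex_bij_witness[of _ ?g ?inv])
      fix h assume h: "h \<in> {h \<in> {h \<in> ?H. inj_on h ?K}. h ` ?K = S}"
      have hin: "h i \<in> S" if "i < k" for i using h that by auto
      have inv: "inv_into ?K (e S) x < k" "e S (inv_into ?K (e S) x) = x" if "x \<in> S" for x
        using that eim inv_into_into[of x "e S" ?K] f_inv_into_f[of x "e S" ?K] by auto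
      show gh: "?g (?inv h) = h"
        using h by (auto simp: fun_eq_iff inv hin PiE_def extensional_def restrict_def)
      have "inj_on (?inv h) ?K"
      proof (rule inj_onI)
        fix x y assume xy: "x \<in> ?K" "y \<in> ?K" "?inv h x = ?inv h y"
        have "e S (?inv h z) = h z" if "z \<in> ?K" for z using inv(2)[OF hin[of z]] that by simp
        then have "h x = h y" using xy by metis
        then show "x = y" using h xy by (auto dest: inj_onD)
      qed
      moreover have "?inv h ` ?K \<subseteq> ?K" using inv hin by auto
      ultimately have "bij_betw (?inv h) ?K ?K"
        using endo_inj_surj[of ?K "?inv h"] unfolding bij_betw_def by blast
      then show "?inv h \<in> ?P" by (auto intro!: bij_imp_permutes)
      show "(\<Prod>i\<in>?K. a i (?g (?inv h) i)) * ?D (?g (?inv h)) = (\<Prod>i\<in>?K. a i (h i)) * ?D h"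
        unfolding gh ..
    next
      fix p assume p: "p \<in> ?P"
      then have pk: "p i < k \<longleftrightarrow> i < k" for i using permutes_in_image[of p ?K i] by auto
      have "p ` ?K = ?K" using p by (auto simp: permutes_image)
      then have im: "(e S \<circ> p) ` ?K = S" using eim by (metis image_comp)
      have "inj_on (e S \<circ> p) ?K"
        using p einj by (metis comp_inj_on mem_Collect_eq permutes_image permutes_inj_on)
      then show "?g p \<in> {h \<in> {h \<in> ?H. inj_on h ?K}. h ` ?K = S}"
        using im S by (auto simp: inj_on_restrict_eq)
      show "?inv (?g p) = p"
      proof
        fix i show "?inv (?g p) i = p i"
          using p pk[of i] inv_into_f_f[OF einj, of "p i"] permutes_not_in[of p ?K i] by auto
      qed
    qed
    \<comment> \<open>Sorting the rows of the minor of \<open>b\<close> costs the sign of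
      \<open>p\<close>, which is the sign that the Leibniz formula for the minor of \<open>a\<close>
      needs.\<close>
    also have "\<dots> = (\<Sum>p\<in>?P. (signof p * (\<Prod>i\<in>?K. a i (e S (p i)))) * ?D (e S))"
    proof (rule sum.cong[OF refl])
      fix p assume p: "p \<in> ?P"
      then have pk: "p i < k" if "i < k" for i using permutes_in_image[of p ?K i] that by auto
      have "mat k k (\<lambda>(i,j). b (?g p i) j)
          = mat k k (\<lambda>(i,j). mat k k (\<lambda>(i,j). b (e S i) j) $$ (p i, j))"
        using pk by (intro eq_matI) auto
      then have "?D (?g p) = signof p * ?D (e S)"
        using det_permute_rows[of "mat k k (\<lambda>(i,j). b (e S i) j)" k p] p by simp
      moreover have "(\<Prod>i\<in>?K. a i (?g p i)) = (\<Prod>i\<in>?K. a i (e S (p i)))" by (rule prod.cong) auto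
      ultimately show "(\<Prod>i\<in>?K. a i (?g p i)) * ?D (?g p)
          = (signof p * (\<Prod>i\<in>?K. a i (e S (p i)))) * ?D (e S)"
        by (simp add: mult_ac)
    qed
    also have "\<dots> = det (mat k k (\<lambda>(i,j). a i (e S j))) * ?D (e S)"
      by (simp add: det_mat sum_distrib_right)
    finally show "(\<Sum>h\<in>{h \<in> {h \<in> ?H. inj_on h ?K}. h ` ?K = S}. (\<Prod>i\<in>?K. a i (h i)) * ?D h)
        = det (mat k k (\<lambda>(i,j). a i (e S j))) * ?D (e S)" .
  qed
  finally show ?thesis .
qed

section \<open>Compound matrices and their spectral calculus\<close>

definition ksubset :: "nat \<Rightarrow> nat \<Rightarrow> nat \<Rightarrow> nat set" where
  "ksubset n k = (SOME f. bij_betw f {0..<n choose k} {S. S \<subseteq> {0..<n} \<and> card S = k})"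

text \<open>The matrix of all minors of order \<open>k\<close>, that is, the \<open>k\<close>-th
  exterior power in the induced basis. Rows and columns follow the arbitrary enumeration
  \<open>ksubset\<close>, of which only bijectivity matters.\<close>

definition compound :: "nat \<Rightarrow> nat \<Rightarrow> complex mat \<Rightarrow> complex mat" where
  "compound n k A = mat (n choose k) (n choose k) (\<lambda>(I,J). det (mat k k (\<lambda>(i,j).
     A $$ (sorted_list_of_set (ksubset n k I) ! i, sorted_list_of_set (ksubset n k J) ! j))))"

lemma bij_betw_ksubset: "bij_betw (ksubset n k) {0..<n choose k} {S. S \<subseteq> {0..<n} \<and> card S = k}"
proof -
  have fin: "finite {S. S \<subseteq> {0..<n} \<and> card S = k}" by simp
  have "card {S. S \<subseteq> {0..<n} \<and> card S = k} = n choose k" using n_subsets[of "{0..<n}" k] by simp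
  then obtain h where "bij_betw h {0..<n choose k} {S. S \<subseteq> {0..<n} \<and> card S = k}"
    using ex_bij_betw_nat_finite[OF fin] by auto
  then show ?thesis unfolding ksubset_def
    by (rule someI[where P = "\<lambda>f. bij_betw f {0..<n choose k} {S. S \<subseteq> {0..<n} \<and> card S = k}"])
qed

lemma ksubset:
  assumes "I < n choose k"
  shows "ksubset n k I \<subseteq> {0..<n}" "card (ksubset n k I) = k"
  using bij_betw_apply[OF bij_betw_ksubset, of I n k] assms by auto

lemma bij_betw_sorted_list_of_set:
  assumes "finite S" "card S = k"
  shows "bij_betw ((!) (sorted_list_of_set S)) {0..<k} S"
  using assms by (intro bij_betw_nth) auto

lemma bij_betw_sorted_ksubset:
  "I < n choose k \<Longrightarrow> bij_betw ((!) (sorted_list_of_set (ksubset n k I))) {0..<k} (ksubset n k I)"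
  using ksubset[of I n k] by (intro bij_betw_sorted_list_of_set) (auto intro: finite_subset)

lemma sorted_ksubset_less:
  assumes "I < n choose k" "i < k"
  shows "sorted_list_of_set (ksubset n k I) ! i < n"
  using bij_betw_apply[OF bij_betw_sorted_ksubset[OF assms(1)], of i] ksubset(1)[OF assms(1)]
    assms(2)
  by auto

lemma compound_carrier [simp]: "compound n k A \<in> carrier_mat (n choose k) (n choose k)"
  by (simp add: compound_def)

lemma compound_mult:
  assumes "A \<in> carrier_mat n n" "B \<in> carrier_mat n n"
  shows "compound n k (A * B) = compound n k A * compound n k B"
proof (rule eq_matI)
  let ?N = "n choose k"
  let ?s = "\<lambda>S. (!) (sorted_list_of_set S)"
  let ?e = "\<lambda>I. ?s (ksubset n k I)"
  fix I J assume "I < dim_row (compound n k A * compound n k B)" "J < dim_col (compound n k A *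
      compound n k B)"
  then have IJ: "I < ?N" "J < ?N" by (simp_all add: compound_def)
  have "compound n k (A * B) $$ (I,J)
      = det (mat k k (\<lambda>(i,j). \<Sum>l = 0..<n. A $$ (?e I i, l) * B $$ (l, ?e J j)))"
    using IJ assms sorted_ksubset_less[OF IJ(1)] sorted_ksubset_less[OF IJ(2)]
    by (auto simp: compound_def scalar_prod_def intro!: arg_cong[of _ _ det] eq_matI)
  also have "\<dots> = (\<Sum>S | S \<subseteq> {0..<n} \<and> card S = k.
        det (mat k k (\<lambda>(i,j). A $$ (?e I i, ?s S j))) * det (mat k k (\<lambda>(i,j). B $$ (?s S i, ?e J
            j))))"
    by (rule Cauchy_Binet) (auto intro: bij_betw_sorted_list_of_set finite_subset)
  also have "\<dots> = (\<Sum>L = 0..<?N.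
        det (mat k k (\<lambda>(i,j). A $$ (?e I i, ?e L j))) * det (mat k k (\<lambda>(i,j). B $$ (?e L i, ?e J
            j))))"
    by (rule sum.reindex_bij_betw[OF bij_betw_ksubset, symmetric])
  also have "\<dots> = (compound n k A * compound n k B) $$ (I,J)"
    using IJ by (simp add: compound_def scalar_prod_def)
  finally show "compound n k (A * B) $$ (I,J) = (compound n k A * compound n k B) $$ (I,J)" .
qed (simp_all add: compound_def)

lemma compound_adjoint:
  assumes "A \<in> carrier_mat n n"
  shows "compound n k (mat_adjoint A) = mat_adjoint (compound n k A)"
proof (rule eq_matI)
  let ?e = "\<lambda>I. (!) (sorted_list_of_set (ksubset n k I))"
  fix I J assume "I < dim_row (mat_adjoint (compound n k A))" "J < dim_col (mat_adjoint (compound n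
      k A))"
  then have IJ: "I < n choose k" "J < n choose k" by (simp_all add: compound_def)
  interpret cnj_hom: comm_ring_hom cnj by standard auto
  let ?M = "mat k k (\<lambda>(i,j). A $$ (?e J i, ?e I j))"
  have "compound n k (mat_adjoint A) $$ (I,J) = det (map_mat cnj (transpose_mat ?M))"
    using IJ assms sorted_ksubset_less[OF IJ(1)] sorted_ksubset_less[OF IJ(2)]
    by (auto simp: compound_def simp del: cnj_hom.hom_det intro!: arg_cong[of _ _ det] eq_matI)
  also have "\<dots> = cnj (det ?M)" by (simp add: det_transpose[of _ k])
  finally show "compound n k (mat_adjoint A) $$ (I,J) = mat_adjoint (compound n k A) $$ (I,J)"
    using IJ by (simp add: compound_def)
qed (simp_all add: compound_def)

lemma compound_diag:
  "compound n k (mat_diag n d) = mat_diag (n choose k) (\<lambda>I. \<Prod>l\<in>ksubset n k I. d l)"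
proof (rule eq_matI)
  let ?e = "\<lambda>I. (!) (sorted_list_of_set (ksubset n k I))"
  let ?D = "mat_diag (n choose k) (\<lambda>I. \<Prod>l\<in>ksubset n k I. d l)"
  fix I J assume "I < dim_row ?D" "J < dim_col ?D"
  then have IJ: "I < n choose k" "J < n choose k" by (auto simp: mat_diag_def)
  let ?M = "mat k k (\<lambda>(i,j). mat_diag n d $$ (?e I i, ?e J j))"
  have c: "compound n k (mat_diag n d) $$ (I,J) = det ?M" using IJ by (simp add: compound_def)
  note less = sorted_ksubset_less[OF IJ(1)] sorted_ksubset_less[OF IJ(2)]
  note bijs = bij_betw_sorted_ksubset[OF IJ(1)] bij_betw_sorted_ksubset[OF IJ(2)]
  show "compound n k (mat_diag n d) $$ (I,J) = ?D $$ (I,J)"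
  proof (cases "I = J")
    case True
    have inj: "?e J i = ?e J j \<longleftrightarrow> i = j" if "i < k" "j < k" for i j
      using bijs(2) that by (auto simp: bij_betw_def dest: inj_onD)
    have "det ?M = prod_list (diag_mat ?M)"
      using True less by (intro det_upper_triangular[of _ k]) (auto simp: mat_diag_def
        inj upper_triangular_def)
    also have "\<dots> = (\<Prod>i = 0..<k. d (?e J i))"
      using True less by (auto simp: prod_list_diag_prod mat_diag_def intro!: prod.cong)
    also have "\<dots> = (\<Prod>l\<in>ksubset n k J. d l)" by (rule prod.reindex_bij_betw[OF bijs(2)])
    finally show ?thesis using c IJ True by (simp add: mat_diag_def)
  next
    case False
    then have "ksubset n k I \<noteq> ksubset n k J"
      using bij_betw_ksubset[of n k] IJ by (auto simp: bij_betw_def dest: inj_onD)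
    \<comment> \<open>Both subsets have \<open>k\<close> elements, so distinct ones are not nested.
      An element of the first that is missing from the second gives a zero row of the minor, which
      kills every Leibniz term.\<close>
    then have "\<not> ksubset n k I \<subseteq> ksubset n k J"
      using ksubset[OF IJ(1)] ksubset[OF IJ(2)]
        by (metis card_subset_eq finite_atLeastLessThan finite_subset)
    then obtain x where x: "x \<in> ksubset n k I" "x \<notin> ksubset n k J" by blast
    then have "x \<in> ?e I ` {0..<k}" using bijs(1) by (simp add: bij_betw_def)
    then obtain i where i: "i < k" "?e I i = x" by auto
    have ne: "?e J j \<noteq> x" if "j < k" for j using x bij_betw_apply[OF bijs(2), of j] that by auto
    have "det ?M = 0" unfolding det_mat
    proof (rule sum.neutral, rule ballI)
      fix p assume "p \<in> {p. p permutes {0..<k}}"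
      then have "p i < k" using permutes_in_image[of p "{0..<k}" i] i by auto
      then have "mat_diag n d $$ (?e I i, ?e J (p i)) = 0"
        using ne[of "p i"] i less by (auto simp: mat_diag_def)
      then have "(\<Prod>i = 0..<k. mat_diag n d $$ (?e I i, ?e J (p i))) = 0"
        using i by (intro prod_zero) auto
      then show "signof p * (\<Prod>i = 0..<k. (\<lambda>(i,j). mat_diag n d $$ (?e I i, ?e J j)) (i, p i)) = 0"
        by simp
    qed
    then show ?thesis using c IJ False by (simp add: mat_diag_def)
  qed
qed (simp_all add: compound_def mat_diag_def)

lemma compound_one: "compound n k (1\<^sub>m n) = 1\<^sub>m (n choose k)"
  using compound_diag[of n k "\<lambda>_. 1"] by simp

lemma compound_unitary:
  assumes "unitary_mat n U"
  shows "unitary_mat (n choose k) (compound n k U)"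
proof (rule unitary_matI)
  have "mat_adjoint (compound n k U) * compound n k U = compound n k (mat_adjoint U * U)"
    using assms by (simp add: compound_adjoint compound_mult)
  then show "mat_adjoint (compound n k U) * compound n k U = 1\<^sub>m (n choose k)"
    using assms by (simp add: unitary_simps compound_one)
qed simp

text \<open>Compounds respect products and adjoints, so they carry a diagonalization to a
  diagonalization. The new eigenvalues are the products of \<open>k\<close> old ones; for sorted
  positive \<open>d\<close> the largest is the product of the first \<open>k\<close>.\<close>

lemma compound_udiag:
  assumes "unitary_mat n U"
  shows "compound n k (udiag n U d) = udiag (n choose k) (compound n k U) (\<lambda>I. \<Prod>l\<in>ksubset n k I. d
    l)"
  using assms
  by (simp add: udiag_def compound_mult compound_adjoint compound_diag of_real_prod)

lemma prod_ksubset_pos: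
  fixes d :: "nat \<Rightarrow> real"
  assumes "\<And>i. i < n \<Longrightarrow> d i > 0" "I < n choose k"
  shows "(\<Prod>l\<in>ksubset n k I. d l) > 0"
  using assms ksubset[of I n k] by (intro prod_pos) auto

text \<open>A power of a product of eigenvalues is the product of their powers, and
  \<open>mpow\<close> may be computed in the diagonalization inherited from
  \<open>A\<close>.\<close>

lemma compound_mpow:
  assumes "pos_def n A"
  shows "pos_def (n choose k) (compound n k A)"
    "compound n k (mpow n A t) = mpow (n choose k) (compound n k A) t"
proof -
  obtain U d where U: "unitary_mat n U" "\<And>i. i < n \<Longrightarrow> d i > 0" "A = udiag n U d"
    "\<And>t. mpow n A t = udiag n U (\<lambda>i. d i powr t)" using assms by (elim pos_defE) blast
  note CU = compound_unitary[OF U(1), of k]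
  have pos: "(\<Prod>l\<in>ksubset n k I. d l) > 0" if "I < n choose k" for I
    using prod_ksubset_pos U(2) that by blast
  show "pos_def (n choose k) (compound n k A)"
    unfolding U(3) compound_udiag[OF U(1)] by (rule pos_def_udiag[OF CU pos])
  have "compound n k (mpow n A t) = udiag (n choose k) (compound n k U) (\<lambda>I. \<Prod>l\<in>ksubset n k I. d l
      powr t)"
    unfolding U(4) compound_udiag[OF U(1)] ..
  also have "\<dots> = udiag (n choose k) (compound n k U) (\<lambda>I. (\<Prod>l\<in>ksubset n k I. d l) powr t)"
  proof (rule udiag_cong)
    fix I
    show "(\<Prod>l\<in>ksubset n k I. d l powr t) = (\<Prod>l\<in>ksubset n k I. d l) powr t"
      by (rule prod_powr_distrib[symmetric])
  qed
  also have "\<dots> = mpow (n choose k) (compound n k A) t"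
    unfolding U(3) compound_udiag[OF U(1)] by (rule mpow_udiag[OF CU pos, symmetric])
  finally show "compound n k (mpow n A t) = mpow (n choose k) (compound n k A) t" .
qed

subsection \<open>Log-majorization\<close>

text \<open>Homogeneity of degree \<open>t\<close> in the second argument; it allows normalizing the
  largest eigenvalue of the mean to 1.\<close>

lemma geo_mean_smult:
  assumes A: "pos_def n A" and B: "pos_def n B" and a: "a > 0"
  shows "geo_mean n A t (complex_of_real a \<cdot>\<^sub>m B) = complex_of_real (a powr t) \<cdot>\<^sub>m geo_mean n A t B"
proof -
  note [simp] = pos_def_carrier[OF A] pos_def_carrier[OF B]
  let ?C = "mpow n A (-1/2) * B * mpow n A (-1/2)"
  have C: "pos_def n ?C" by (rule pos_def_mpow_congruence[OF B A])
  have "mpow n A (-1/2) * (complex_of_real a \<cdot>\<^sub>m B) * mpow n A (-1/2) = complex_of_real a \<cdot>\<^sub>m ?C"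
    using A B by (simp add: mult_smult_distrib[of _ n n _ n] mult_smult_assoc_mat[of _ n n _ n])
  then show ?thesis
    unfolding geo_mean_def using A C mpow_smult(2)[OF C a, of t]
    by (simp add: mult_smult_distrib[of _ n n _ n] mult_smult_assoc_mat[of _ n n _ n])
qed

lemma pos_def_geo_mean:
  assumes A: "pos_def n A" and B: "pos_def n B"
  shows "pos_def n (geo_mean n A t B)"
  unfolding geo_mean_def
  by (intro pos_def_mpow_congruence pos_def_mpow A B)

lemma compound_geo_mean:
  assumes A: "pos_def n A" and B: "pos_def n B"
  shows "compound n k (geo_mean n A t B) = geo_mean (n choose k) (compound n k A) t (compound n k
    B)"
proof -
  note [simp] = pos_def_carrier[OF A] pos_def_carrier[OF B]
  have C: "pos_def n (mpow n A (-1/2) * B * mpow n A (-1/2))"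
      by (rule pos_def_mpow_congruence[OF B A])
  show ?thesis
    unfolding geo_mean_def using A B C by (simp add: compound_mult compound_mpow(2))
qed

section \<open>Determinants, for the equality at k = n\<close>

lemma det_mat_diag: "det (mat_diag n f) = (\<Prod>i<n. f i)"
  by (subst det_upper_triangular[of _ n])
     (auto simp: mat_diag_def prod_list_diag_prod atLeast0LessThan upper_triangular_def)

lemma det_udiag:
  assumes "unitary_mat n U"
  shows "det (udiag n U d) = complex_of_real (\<Prod>i<n. d i)"
proof -
  note [simp] = unitary_carrier[OF assms]
  have "det U * det (mat_adjoint U) = 1"
    using det_mult[of U n "mat_adjoint U"] by (simp add: unitary_simps[OF assms])
  then show ?thesis
    by (simp add: udiag_def det_mult[of _ n] det_mat_diag mult_ac)
qed

lemma det_pos_def: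
  assumes "pos_def n A"
  obtains a where "a > 0" "det A = complex_of_real a" "\<And>t. det (mpow n A t)
      = complex_of_real (a powr t)"
proof -
  obtain U d where U: "unitary_mat n U" "\<And>i. i < n \<Longrightarrow> d i > 0" "A = udiag n U d"
    "\<And>t. mpow n A t = udiag n U (\<lambda>i. d i powr t)" using assms by (elim pos_defE) blast
  show ?thesis
  proof
    show "(\<Prod>i<n. d i) > 0" using U(2) by (intro prod_pos) auto
    show "det A = complex_of_real (\<Prod>i<n. d i)" using det_udiag[OF U(1)] U(3) by simp
    show "det (mpow n A t) = complex_of_real ((\<Prod>i<n. d i) powr t)" for t
      unfolding U(4) det_udiag[OF U(1)] by (simp add: prod_powr_distrib)
  qed
qed

text \<open>Both determinants are \<open>det(A)^(1-t) det(B)^t\<close>, since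
  \<open>det C = det(B) / det(A)\<close>.\<close>

lemma det_geo_mean:
  assumes A: "pos_def n A" and B: "pos_def n B"
  shows "det (mpow n A ((1 - t) / 2) * mpow n B t * mpow n A ((1 - t) / 2))
    = det (geo_mean n A t B)"
proof -
  note [simp] = pos_def_carrier[OF A] pos_def_carrier[OF B]
  obtain a where a: "a > 0" "\<And>t. det (mpow n A t) = complex_of_real (a powr t)"
    using A by (elim det_pos_def) blast
  obtain b where b: "b > 0" "det B = complex_of_real b" "\<And>t. det (mpow n B t)
      = complex_of_real (b powr t)"
    using B by (elim det_pos_def) blast
  let ?C = "mpow n A (-1/2) * B * mpow n A (-1/2)"
  have C: "pos_def n ?C" by (rule pos_def_mpow_congruence[OF B A])
  obtain c where c: "c > 0" "det ?C = complex_of_real c" "\<And>t. det (mpow n ?C t)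
      = complex_of_real (c powr t)"
    using C by (elim det_pos_def) blast
  have "det ?C = complex_of_real (a powr (-1/2) * b * a powr (-1/2))"
    using A by (simp add: det_mult[of _ n] a(2) b(2))
  then have "c = a powr (-1/2) * b * a powr (-1/2)" using c(2) by (simp only: of_real_eq_iff)
  also have "\<dots> = b * (a powr (-1/2) * a powr (-1/2))" by simp
  also have "\<dots> = b * a powr (-1)" by (simp add: powr_add[symmetric])
  finally have c_eq: "c = b * a powr (-1)" .
  have "det (geo_mean n A t B) = complex_of_real (a powr (1/2) * c powr t * a powr (1/2))"
    unfolding geo_mean_def using A C c(3)[of t] by (simp add: det_mult[of _ n] a(2))
  also have "a powr (1/2) * c powr t * a powr (1/2)
      = a powr ((1 - t) / 2) * b powr t * a powr ((1 - t) / 2)"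
  proof -
    have "c powr t = b powr t * (a powr (-1)) powr t"
      unfolding c_eq using a(1) b(1) by (subst powr_mult) auto
    then have "c powr t = b powr t * a powr (-t)" by (simp only: powr_powr) simp
    then have "a powr (1/2) * c powr t * a powr (1/2)
        = b powr t * (a powr (1/2) * a powr (-t) * a powr (1/2))"
      by (simp only: mult_ac)
    also have "a powr (1/2) * a powr (-t) * a powr (1/2)
        = a powr ((1 - t) / 2) * a powr ((1 - t) / 2)"
      unfolding powr_add[symmetric] by (rule arg_cong[of _ _ "\<lambda>x. a powr x"])
        (simp add: field_simps)
    finally show ?thesis by (simp add: mult_ac)
  qed
  also have "complex_of_real \<dots> = det (mpow n A ((1 - t) / 2) * mpow n B t * mpow n A ((1 - t) / 2))"
    using A B by (simp add: det_mult[of _ n] a(2) b(3))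
  finally show ?thesis ..
qed

section \<open>Singular values of positive definite matrices\<close>

lemma char_poly_udiag:
  assumes "unitary_mat n U"
  shows "char_poly (udiag n U d) = (\<Prod>i<n. [:- complex_of_real (d i), 1:])"
proof -
  let ?D = "mat_diag n (\<lambda>i. complex_of_real (d i))"
  have "similar_mat (udiag n U d) ?D"
    unfolding similar_mat_def
    by (intro exI[of _ U] exI[of _ "mat_adjoint U"] similar_mat_witI[of _ _ n])
       (use assms in \<open>auto simp: udiag_def unitary_simps[OF assms]\<close>)
  then have "char_poly (udiag n U d) = char_poly ?D" by (rule char_poly_similar)
  also have "\<dots> = (\<Prod>a\<leftarrow>diag_mat ?D. [:- a, 1:])"
    by (intro char_poly_upper_triangular[of _ n]) (auto simp: mat_diag_def)
  also have "diag_mat ?D = map (\<lambda>i. complex_of_real (d i)) [0..<n]"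
    by (auto simp: diag_mat_def mat_diag_def)
  finally show ?thesis
    by (simp add: prod.distinct_set_conv_list[symmetric] atLeast0LessThan o_def)
qed

text \<open>A multiset has only one decreasing enumeration. The lists are reversed because
  \<open>sorted\<close> means ascending.\<close>

lemma antimono_eq_of_image_mset_eq:
  fixes s d :: "nat \<Rightarrow> real"
  assumes "\<And>i j. i \<le> j \<Longrightarrow> j < n \<Longrightarrow> s j \<le> s i" "\<And>i j. i \<le> j \<Longrightarrow> j < n \<Longrightarrow> d j \<le> d i"
    and eq: "image_mset s (mset [0..<n]) = image_mset d (mset [0..<n])" and "i < n"
  shows "s i = d i"
proof -
  have sorted: "sorted (rev (map f [0..<n]))" if "\<And>i j. i \<le> j \<Longrightarrow> j < n \<Longrightarrow> f j \<le> f i"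
      for f :: "nat \<Rightarrow> real"
    using that by (auto simp: sorted_iff_nth_mono rev_nth)
  have "sort (rev (map s [0..<n])) = rev (map d [0..<n])"
    using eq by (intro properties_for_sort sorted assms(2)) auto
  moreover have "sort (rev (map s [0..<n])) = rev (map s [0..<n])"
    by (intro sort_key_id_if_sorted[where f = "\<lambda>x. x", simplified] sorted_sort_id sorted assms(1))
  ultimately have "map s [0..<n] = map d [0..<n]" by simp
  then show ?thesis using \<open>i < n\<close> by simp
qed

text \<open>\<open>d\<close> itself satisfies the specification of \<open>sing_vals\<close>, so the
  chosen sequence does too. Both then give the same characteristic polynomial, hence the same
  multiset of squares; nonnegativity removes the squares and the decreasing order identifies the
  sequences.\<close>

lemma sing_vals_udiag:
  assumes U: "unitary_mat n U" and pos: "\<And>i. i < n \<Longrightarrow> d i > 0"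
    and dec: "\<And>i j. i \<le> j \<Longrightarrow> j < n \<Longrightarrow> d j \<le> d i" and "i < n"
  shows "sing_vals n (udiag n U d) i = d i"
proof -
  let ?A = "udiag n U d"
  let ?P = "\<lambda>s. (\<forall>i<n. s i \<ge> 0) \<and> (\<forall>i j. i \<le> j \<and> j < n \<longrightarrow> s j \<le> s i)
    \<and> char_poly (mat_adjoint ?A * ?A) = (\<Prod>i<n. [:- complex_of_real ((s i)\<^sup>2), 1:])"
  have cp: "char_poly (mat_adjoint ?A * ?A) = (\<Prod>i<n. [:- complex_of_real ((d i)\<^sup>2), 1:])"
    using U by (simp add: udiag_mult char_poly_udiag power2_eq_square)
  then have "?P d" using pos dec by (auto simp: less_imp_le)
  then have P: "?P (sing_vals n ?A)" unfolding sing_vals_def by (rule someI[of ?P])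
  let ?s = "sing_vals n ?A"
  have roots: "proots (\<Prod>i<n. [:- complex_of_real ((f i)\<^sup>2), 1:])
      = image_mset (\<lambda>i. complex_of_real ((f i)\<^sup>2)) (mset [0..<n])"
    for f :: "nat \<Rightarrow> real"
  proof -
    have "(\<Prod>i<n. [:- complex_of_real ((f i)\<^sup>2), 1:])
        = (\<Prod>i\<leftarrow>[0..<n]. [:- complex_of_real ((f i)\<^sup>2), 1:])"
      by (simp add: prod.distinct_set_conv_list[symmetric] atLeast0LessThan)
    moreover have "proots (\<Prod>i\<leftarrow>is. [:- complex_of_real ((f i)\<^sup>2), 1:])
        = image_mset (\<lambda>i. complex_of_real ((f i)\<^sup>2)) (mset is)"
      for "is"
    proof (induction "is")
      case (Cons a "is")
      have "(\<Prod>i\<leftarrow>is. [:- complex_of_real ((f i)\<^sup>2), 1:]) \<noteq> 0" by (auto simp: prod_list_zero_iff)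
      then have "proots ([:- complex_of_real ((f a)\<^sup>2), 1:] * (\<Prod>i\<leftarrow>is. [:- complex_of_real ((f i)\<^sup>2),
          1:]))
          = proots [:- complex_of_real ((f a)\<^sup>2), 1:] + proots (\<Prod>i\<leftarrow>is. [:- complex_of_real ((f
              i)\<^sup>2), 1:])"
        by (intro proots_mult) auto
      then show ?case using Cons.IH by (simp del: mult_pCons_left)
    qed simp
    ultimately show ?thesis by simp
  qed
  have sqrt: "image_mset (\<lambda>z. sqrt (Re z)) (image_mset (\<lambda>i. complex_of_real ((f i)\<^sup>2)) (mset
      [0..<n]))
      = image_mset f (mset [0..<n])" if "\<forall>i<n. f i \<ge> 0" for f :: "nat \<Rightarrow> real"
    unfolding image_mset.compositionality
    by (rule image_mset_cong) (use that in \<open>auto simp: real_sqrt_unique\<close>)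
  have "image_mset (\<lambda>i. complex_of_real ((?s i)\<^sup>2)) (mset [0..<n])
      = image_mset (\<lambda>i. complex_of_real ((d i)\<^sup>2)) (mset [0..<n])"
    using P cp by (metis roots)
  then have "image_mset ?s (mset [0..<n]) = image_mset d (mset [0..<n])"
    using sqrt[of ?s] sqrt[of d] P pos by (simp add: less_imp_le)
  then show ?thesis using P dec \<open>i < n\<close> by (intro antimono_eq_of_image_mset_eq[of n]) auto
qed

text \<open>Remove the common indices in \<open>S\<close> and \<open>{..<k}\<close>. Equally many
  remain on both sides, and the threshold \<open>c = d (k - 1)\<close> separates them: factors with
  index at least \<open>k\<close> are at most \<open>c\<close>, those below \<open>k\<close> at
  least \<open>c\<close>.\<close>

lemma prod_subset_le_prod_initial:
  fixes d :: "nat \<Rightarrow> real"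
  assumes pos: "\<And>i. i < n \<Longrightarrow> d i > 0" and dec: "\<And>i j. i \<le> j \<Longrightarrow> j < n \<Longrightarrow> d j \<le> d i"
    and S: "S \<subseteq> {0..<n}" "card S = k"
  shows "(\<Prod>i\<in>S. d i) \<le> (\<Prod>i<k. d i)"
proof (cases "k = 0")
  case True
  then show ?thesis using S by (auto dest: finite_subset)
next
  case False
  have fin: "finite S" using S(1) finite_subset by blast
  have kn: "k \<le> n" using S card_mono[of "{0..<n}" S] by auto
  define c where "c = d (k - 1)"
  have c: "c > 0" using pos False kn by (simp add: c_def)
  let ?K = "{..<k}"
  have card: "card (S - ?K) = card (?K - S)"
    using card_Diff_subset_Int[of S ?K] card_Diff_subset_Int[of ?K S] S fin by
      (simp add: Int_commute)
  have "(\<Prod>i\<in>S - ?K. d i) \<le> (\<Prod>i\<in>S - ?K. c)"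
    using S pos dec False unfolding c_def by (intro prod_mono) (auto simp: less_imp_le subset_eq)
  also have "\<dots> = (\<Prod>i\<in>?K - S. c)" by (simp add: card)
  also have "\<dots> \<le> (\<Prod>i\<in>?K - S. d i)"
    using c dec kn False unfolding c_def by (intro prod_mono) (auto simp: less_imp_le)
  finally have "(\<Prod>i\<in>S \<inter> ?K. d i) * (\<Prod>i\<in>S - ?K. d i) \<le> (\<Prod>i\<in>S \<inter> ?K. d i) * (\<Prod>i\<in>?K - S. d i)"
    using S pos by (intro mult_left_mono prod_nonneg) (auto simp: less_imp_le subset_eq)
  moreover have "(\<Prod>i\<in>S. d i) = (\<Prod>i\<in>S \<inter> ?K. d i) * (\<Prod>i\<in>S - ?K. d i)"
    by (rule prod.Int_Diff[OF fin])
  moreover have "(\<Prod>i<k. d i) = (\<Prod>i\<in>S \<inter> ?K. d i) * (\<Prod>i\<in>?K - S. d i)"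
    using prod.Int_Diff[of ?K d S] by (simp add: Int_commute)
  ultimately show ?thesis by simp
qed

lemma pos_def_sorted_decomposition:
  assumes "pos_def n A"
  obtains U d where "unitary_mat n U" "\<And>i. i < n \<Longrightarrow> d i > 0"
    "\<And>i j. i \<le> j \<Longrightarrow> j < n \<Longrightarrow> d j \<le> d i" "A = udiag n U d"
    "\<And>i. i < n \<Longrightarrow> sing_vals n A i = d i"
proof -
  have "hermitian_mat n A" using assms by (simp add: hermitian_mat_def pos_def_carrier[of n]
      pos_def_adjoint[of n])
  then obtain U d where U: "unitary_mat n U" "\<forall>i<n. d i > 0" "\<forall>i j. i \<le> j \<and> j < n \<longrightarrow> d j \<le> d i" "A
      = udiag n U d"
    using pos_def_sorted qform_pos[OF assms] by metis
  then show ?thesis using sing_vals_udiag[OF U(1), of d] by (intro that[of U d]) auto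
qed

lemma log_majorized_pos_def:
  assumes A: "pos_def n A" and B: "pos_def n B" and t: "1 \<le> t" "t \<le> 2"
  shows "log_majorized n (mpow n A ((1 - t) / 2) * mpow n B t * mpow n A ((1 - t) / 2)) (geo_mean n
    A t B)"
    (is "log_majorized n ?M ?G")
proof -
  note [simp] = pos_def_carrier[OF A] pos_def_carrier[OF B]
  have M: "pos_def n ?M" by (intro pos_def_mpow_congruence pos_def_mpow A B)
  have G: "pos_def n ?G" by (rule pos_def_geo_mean[OF A B])
  obtain U m where U: "unitary_mat n U" "\<And>i. i < n \<Longrightarrow> m i > 0" "\<And>i j. i \<le> j \<Longrightarrow> j < n \<Longrightarrow> m j \<le> m i"
    "?M = udiag n U m" "\<And>i. i < n \<Longrightarrow> sing_vals n ?M i = m i"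
    using pos_def_sorted_decomposition[OF M] by metis
  obtain V g where V: "unitary_mat n V" "\<And>i. i < n \<Longrightarrow> g i > 0" "\<And>i j. i \<le> j \<Longrightarrow> j < n \<Longrightarrow> g j \<le> g i"
    "?G = udiag n V g" "\<And>i. i < n \<Longrightarrow> sing_vals n ?G i = g i"
    using pos_def_sorted_decomposition[OF G] by metis
  have le: "(\<Prod>i<k. m i) \<le> (\<Prod>i<k. g i)" if k: "k \<le> n" for k
  proof -
    let ?N = "n choose k"
    \<comment> \<open>\<open>c\<close> is the largest eigenvalue of the compound of
      \<open>?G\<close>, and \<open>a\<close> is chosen with \<open>a^t = 1/c\<close>, so that
      rescaling \<open>B\<close> brings it down to 1.\<close>
    define c where "c = (\<Prod>i<k. g i)"
    have c: "c > 0" unfolding c_def using V(2) k by (intro prod_pos) auto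
    define a where "a = c powr (- 1 / t)"
    have "a powr t = c powr (- 1 / t * t)" by (simp only: a_def powr_powr)
    then have a: "a > 0" "a powr t = inverse c" using c t by (simp_all add: a_def powr_minus)
    let ?A = "compound n k A"
    let ?B = "complex_of_real a \<cdot>\<^sub>m compound n k B"
    note AB = compound_mpow(1)[OF A, of k] compound_mpow(1)[OF B, of k]
    note aB = mpow_smult[OF AB(2) a(1)]
    note CU = compound_unitary[OF U(1), of k] and CV = compound_unitary[OF V(1), of k]
    have "geo_mean ?N ?A t ?B = complex_of_real (inverse c) \<cdot>\<^sub>m compound n k ?G"
      using geo_mean_smult[OF AB a(1), of t] by (simp only: compound_geo_mean[OF A B] a(2))
    also have "\<dots> = udiag ?N (compound n k V) (\<lambda>I. inverse c * (\<Prod>l\<in>ksubset n k I. g l))"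
      unfolding V(4) compound_udiag[OF V(1)] by (rule udiag_smult[OF CV])
    finally have "mat_le ?N (geo_mean ?N ?A t ?B) (1\<^sub>m ?N)"
    proof (simp only: mat_le_one_iff[OF CV], intro allI impI)
      fix I assume "I < ?N"
      then have "(\<Prod>l\<in>ksubset n k I. g l) \<le> c" unfolding c_def
        by (intro prod_subset_le_prod_initial[of n] V ksubset) auto
      then show "inverse c * (\<Prod>l\<in>ksubset n k I. g l) \<le> 1" using c by (simp add: field_simps)
    qed
    then have "mat_le ?N (mpow ?N ?A ((1 - t) / 2) * mpow ?N ?B t * mpow ?N ?A ((1 - t) / 2)) (1\<^sub>m
        ?N)"
      by (rule geo_mean_le_one[OF AB(1) aB(1) t])
    \<comment> \<open>The left-hand side is also homogeneous of degree \<open>t\<close> in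
      \<open>B\<close>, so it picks up the same factor \<open>1/c\<close>.\<close>
    also have "mpow ?N ?A ((1 - t) / 2) * mpow ?N ?B t * mpow ?N ?A ((1 - t) / 2)
        = complex_of_real (inverse c) \<cdot>\<^sub>m compound n k ?M"
    proof -
      have "compound n k ?M = mpow ?N ?A ((1 - t) / 2) * mpow ?N (compound n k B) t * mpow ?N ?A ((1
          - t) / 2)"
        using A B by (simp add: compound_mult compound_mpow(2))
      then show ?thesis using AB
        by (simp add: aB(2) a(2) mult_smult_distrib[of _ ?N ?N _ ?N] mult_smult_assoc_mat[of _ ?N ?N
          _ ?N])
    qed
    also have "\<dots> = udiag ?N (compound n k U) (\<lambda>I. inverse c * (\<Prod>l\<in>ksubset n k I. m l))"
      unfolding U(4) compound_udiag[OF U(1)] by (rule udiag_smult[OF CU])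
    finally have *: "\<forall>I<?N. inverse c * (\<Prod>l\<in>ksubset n k I. m l) \<le> 1"
      unfolding mat_le_one_iff[OF CU] .
    \<comment> \<open>The eigenvalue indexed by the initial segment is the product of the
      \<open>k\<close> largest \<open>m i\<close>; its bound is the claim.\<close>
    have "{..<k} \<in> {S. S \<subseteq> {0..<n} \<and> card S = k}" using k by auto
    then have "{..<k} \<in> ksubset n k ` {0..<?N}"
      by (simp only: bij_betw_imp_surj_on[OF bij_betw_ksubset])
    then obtain I where I: "I < ?N" "ksubset n k I = {..<k}" by auto
    show ?thesis using *[rule_format, OF I(1)] c unfolding I(2) c_def[symmetric] by
        (simp add: field_simps)
  qed
  have "complex_of_real (\<Prod>i<n. m i) = complex_of_real (\<Prod>i<n. g i)"
    using det_geo_mean[OF A B, of t] unfolding U(4) V(4) det_udiag[OF U(1)] det_udiag[OF V(1)] .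
  then have "(\<Prod>i<n. m i) = (\<Prod>i<n. g i)" by (simp only: of_real_eq_iff)
  moreover have "(\<Prod>i<k. sing_vals n ?M i) = (\<Prod>i<k. m i)" "(\<Prod>i<k. sing_vals n ?G i) = (\<Prod>i<k. g i)"
    if "k \<le> n" for k
    using that U(5) V(5) by (auto intro!: prod.cong)
  ultimately show ?thesis using le by (simp add: log_majorized_def)
qed

section \<open>Exponentials of Hermitian matrices\<close>

lemma udiag_pow: "unitary_mat n U \<Longrightarrow> udiag n U d ^\<^sub>m k = udiag n U (\<lambda>i. d i ^ k)"
proof (induction k)
  case 0
  then show ?case using udiag_one[OF 0] carrier_matD[OF udiag_carrier[OF 0, of d]] by simp
qed (simp add: udiag_mult mult.commute)

lemma udiag_index:
  assumes "unitary_mat n U" "i < n" "j < n"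
  shows "udiag n U d $$ (i,j) = (\<Sum>l<n. U $$ (i,l) * complex_of_real (d l) * cnj (U $$ (j,l)))"
proof -
  note c = unitary_carrier[OF assms(1)]
  show ?thesis using assms carrier_matD[OF c]
    unfolding udiag_def mat_diag_mult_right[OF c] by (simp add: scalar_prod_def atLeast0LessThan)
qed

text \<open>Each entry of the matrix series is a fixed finite combination of the scalar exponential
  series at the eigenvalues, so it can be summed termwise.\<close>

lemma mexp_udiag:
  assumes U: "unitary_mat n U"
  shows "mexp (udiag n U d) = udiag n U (\<lambda>i. exp (d i))"
proof (rule eq_matI)
  note [simp] = carrier_matD[OF udiag_carrier[OF U]]
  show "dim_row (mexp (udiag n U d)) = dim_row (udiag n U (\<lambda>i. exp (d i)))"
    "dim_col (mexp (udiag n U d)) = dim_col (udiag n U (\<lambda>i. exp (d i)))"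
    by (simp_all add: mexp_def)
  fix i j assume "i < dim_row (udiag n U (\<lambda>i. exp (d i)))" "j < dim_col (udiag n U (\<lambda>i. exp (d i)))"
  then have ij: "i < n" "j < n" by simp_all
  have "(\<lambda>k. U $$ (i,l) * complex_of_real (d l ^ k / fact k) * cnj (U $$ (j,l)))
      sums (U $$ (i,l) * complex_of_real (exp (d l)) * cnj (U $$ (j,l)))" for l
    using exp_converges[of "d l"]
    by (intro sums_mult sums_mult2 sums_of_real) (simp add: divide_inverse mult.commute)
  then have "(\<lambda>k. \<Sum>l<n. U $$ (i,l) * complex_of_real (d l ^ k / fact k) * cnj (U $$ (j,l)))
      sums udiag n U (\<lambda>i. exp (d i)) $$ (i,j)"
    unfolding udiag_index[OF U ij] by (intro sums_sum) simp
  moreover have "(udiag n U d ^\<^sub>m k) $$ (i,j) / of_real (fact k)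
      = (\<Sum>l<n. U $$ (i,l) * complex_of_real (d l ^ k / fact k) * cnj (U $$ (j,l)))" for k
    unfolding udiag_pow[OF U] udiag_index[OF U ij] by (simp add: sum_divide_distrib)
  ultimately show "mexp (udiag n U d) $$ (i,j) = udiag n U (\<lambda>i. exp (d i)) $$ (i,j)"
    using ij by (simp add: mexp_def sums_iff)
qed

text \<open>All exponentials in the theorem thereby become real powers of two positive definite
  matrices, which reduces it to \<open>log_majorized_pos_def\<close>.\<close>

lemma mexp_hermitian:
  assumes "hermitian_mat n H"
  shows "pos_def n (mexp H)" "mexp (complex_of_real c \<cdot>\<^sub>m H) = mpow n (mexp H) c"
proof -
  obtain U d where U: "unitary_mat n U" "H = udiag n U d" using hermitian_udiag_sorted[OF assms]
      by blast
  show "pos_def n (mexp H)" using U by (simp add: mexp_udiag pos_def_udiag)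
  have "mexp (complex_of_real c \<cdot>\<^sub>m H) = udiag n U (\<lambda>i. exp (c * d i))"
    using U by (simp add: udiag_smult mexp_udiag)
  also have "\<dots> = mpow n (mexp H) c"
    using U by (simp add: mexp_udiag mpow_udiag exp_powr_real mult.commute)
  finally show "mexp (complex_of_real c \<cdot>\<^sub>m H) = mpow n (mexp H) c" .
qed

theorem theorem5:
  fixes n :: nat and H K :: "complex mat" and t :: real
  assumes "hermitian_mat n H" and "hermitian_mat n K"
    and "1 \<le> t" and "t \<le> 2"
  shows "log_majorized n
     (mexp (complex_of_real ((1 - t) / 2) \<cdot>\<^sub>m H) * mexp (complex_of_real t \<cdot>\<^sub>m K)
        * mexp (complex_of_real ((1 - t) / 2) \<cdot>\<^sub>m H))
     (geo_mean n (mexp H) t (mexp K))"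
  unfolding mexp_hermitian(2)[OF assms(1)] mexp_hermitian(2)[OF assms(2)]
  by (intro log_majorized_pos_def mexp_hermitian(1) assms)

end
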